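(* Let $\Delta=[\boldsymbol p_1,\boldsymbol p_2,\boldsymbol p_3]$ and $\hat\Delta=[\boldsymbol p_1,\boldsymbol p_2,\hat{\boldsymbol p}_3]$ be nondegenerate triangles in $\mathbb R^2$ sharing the edge $e=[\boldsymbol p_1,\boldsymbol p_2]$, and let $$F(\boldsymbol x)=\sum_{i=1}^{16}c_iS_{\sigma_i,3}(\boldsymbol x),\ \boldsymbol x\in\Delta,\qquad \hat F(\boldsymbol x)=\sum_{i=1}^{16}\hat c_i\hat S_{\sigma_i,3}(\boldsymbol x),\ \boldsymbol x\in\hat\Delta,$$ with real coefficients $c_i,\hat c_i$ and with $S_{j,3},\hat S_{j,3}$ and the reordering $\sigma$ as defined in the context. Let $\beta_1,\beta_2,\beta_3$ be the barycentric coordinates of $\hat{\boldsymbol p}_3$ with respect to $\Delta$. Then $F$ and $\hat F$ meet along $e$ with $C^0$-smoothness if and only if $$\hat c_1=c_1,\quad\hat c_2=c_2,\quad\hat c_3=c_3,\quad\hat c_4=c_4,\quad\hat c_5=c_5;$$ $C^1$-smoothness if and only if in addition $$\hat c_6=\beta_1c_1+\beta_2c_2+\beta_3c_6,\qquad\hat c_7=\beta_1c_2+\beta_2\frac{c_2+c_3}2+\beta_3c_7,$$ $$\hat c_9=\beta_1c_4+\beta_2c_5+\beta_3c_9,\qquad\hat c_8=\beta_2c_4+\beta_1\frac{c_3+c_4}2+\beta_3c_8;$$ $C^2$-smoothness if and only if, in addition to the five $C^0$ equations $\hat c_i=c_i$, $i=1,\dots,5$, and the four $C^1$ equations $\hat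 c_6=\beta_1c_1+\beta_2c_2+\beta_3c_6$, $\hat c_7=\beta_1c_2+\beta_2\frac{c_2+c_3}2+\beta_3c_7$, $\hat c_9=\beta_1c_4+\beta_2c_5+\beta_3c_9$, $\hat c_8=\beta_2c_4+\beta_1\frac{c_3+c_4}2+\beta_3c_8$, $$\hat c_{10}=2\beta_1\beta_2\frac{3c_2-c_1}2+2\beta_1\beta_3\frac{3c_6-c_1}2+2\beta_2\beta_3\frac{4c_7-c_2-c_6}2+\beta_1^2c_1+\beta_2^2c_3+\beta_3^2c_{10},$$ $$\hat c_{12}=2\beta_1\beta_2\frac{3c_4-c_5}2+2\beta_2\beta_3\frac{3c_9-c_5}2+2\beta_1\beta_3\frac{4c_8-c_4-c_9}2+\beta_1^2c_3+\beta_2^2c_5+\beta_3^2c_{12},$$ $$\begin{aligned}\hat c_{11}={}&2\beta_1\beta_2\frac{c_1-2c_2+4c_3-2c_4+c_5}2+\beta_3^2c_{11}\\&+2\beta_1\beta_3\frac{c_1-2c_2+c_3-3c_6+6c_7-2c_8+c_9}2+\beta_2^2(2c_4-c_5)\\&+2\beta_2\beta_3\frac{c_3-2c_4+c_5-3c_9+6c_8-2c_7+c_6}2+\beta_1^2(2c_2-c_1).\end{aligned}$$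
   Context: **Meeting smoothly.** $F$ and $\hat F$ meet with $C^r$-smoothness along $e$ if all partial derivatives of order $\le r$ of $F$ and $\hat F$ agree on $e$ (derivatives at the edge taken from the respective triangle). **Simplex splines.** With $\boldsymbol p_4=\frac{\boldsymbol p_1+\boldsymbol p_2}2$, $\boldsymbol p_5=\frac{\boldsymbol p_2+\boldsymbol p_3}2$, $\boldsymbol p_6=\frac{\boldsymbol p_3+\boldsymbol p_1}2$, write $Q[ijklmn]=Q[\mathcal K]$ for the multiset $\mathcal K=\{\boldsymbol p_1^i\boldsymbol p_2^j\boldsymbol p_3^k\boldsymbol p_4^l\boldsymbol p_5^m\boldsymbol p_6^n\}$ (exponents are multiplicities) with $i+j+k+l+m+n=6$, where, listing the elements of $\mathcal K$ as $\boldsymbol k_1,\dots,\boldsymbol k_6$ and choosing a simplex $\tau=[\overline{\boldsymbol k}_1,\dots,\overline{\boldsymbol k}_6]\subset\mathbb R^5$ with vertices projecting to $\boldsymbol k_1,\dots,\boldsymbol k_6$ under the projection $\boldsymbol P$ onto the first two coordinates, $$Q[\mathcal K](\boldsymbol x)=\mathrm{area}(\Delta)\binom52^{-1}\frac{\mathrm{vol}_3(\tau\cap\boldsymbol P^{-1}(\boldsymbol x))}{\mathrm{vol}_5(\tau)}.$$ These are $C^2$ piecewise cubics on the Powell–Sabin 12-split of $\Delta$ (the subdivision of $\Delta$ by the complete graph on $\boldsymbol p_1,\dots,\boldsymbol p_6$). **Basis** $\boldsymbol s_3=[S_{1,3},\dots,S_{16,3}]$: $\frac14Q[400101]$, $\frac12Q[310101]$,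 $Q[221100]$, $\frac12Q[130110]$, $\frac14Q[040110]$, $\frac12Q[031110]$, $Q[122010]$, $\frac12Q[013011]$, $\frac14Q[004011]$, $\frac12Q[103011]$, $Q[212001]$, $\frac12Q[301101]$, $Q[211101]$, $Q[121110]$, $Q[112011]$, $\frac14Q[111111]$. $\hat S_{j,3}=S_{j,3}\circ\boldsymbol A$, where $\boldsymbol A:\hat\Delta\to\Delta$ is the affine map fixing $\boldsymbol p_1,\boldsymbol p_2$ and mapping $\hat{\boldsymbol p}_3$ to $\boldsymbol p_3$. **Reordering:** $\sigma=[\sigma_i]_{i=1}^{16}=[1,2,3,4,5,12,13,14,6,11,16,7,15,10,8,9]$. *)

theory Defs
  imports "HOL-Analysis.Analysis"
begin

type_synonym plane = "real ^ 2"

text \<open>\<open>\<real>\<^sup>5\<close> is represented as \<open>\<real>\<^sup>2 \<times> \<real>\<^sup>3\<close>, so that the projection onto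
  the first two coordinates is \<^const>\<open>fst\<close>.\<close>

type_synonym space5 = "plane \<times> (real ^ 3)"

definition lifted_simplex :: "plane list \<Rightarrow> space5 list \<Rightarrow> bool" where
  "lifted_simplex ks vs \<longleftrightarrow> map fst vs = ks \<and> distinct vs \<and> \<not> affine_dependent (set vs)"

text \<open>The fibre of the projection over \<open>x\<close> is \<open>{x} \<times> \<real>\<^sup>3\<close>, so the 3-volume of its
  intersection with the simplex is the Lebesgue measure of a subset of \<open>\<real>\<^sup>3\<close>. The simplex is
  closed; hence on the boundary of its support a simplex spline takes the limit value from
  inside the support. For six knots that affinely span the plane a nondegenerate lifted
  simplex exists, and the volume quotient does not depend on which one is chosen.\<close>

definition simplex_spline :: "plane set \<Rightarrow> plane list \<Rightarrow> plane \<Rightarrow> real" where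
  "simplex_spline \<Delta> ks x =
    (let \<tau> = convex hull (set (SOME vs. lifted_simplex ks vs))
     in measure lborel \<Delta> / real (5 choose 2) *
        (measure lborel {y. (x, y) \<in> \<tau>} / measure lborel \<tau>))"

definition Q12 :: "plane \<Rightarrow> plane \<Rightarrow> plane \<Rightarrow> nat \<Rightarrow> nat \<Rightarrow> nat \<Rightarrow> nat \<Rightarrow> nat \<Rightarrow> nat \<Rightarrow> plane \<Rightarrow> real" where
  "Q12 p1 p2 p3 i j k l m n =
    simplex_spline (convex hull {p1, p2, p3})
      (replicate i p1 @ replicate j p2 @ replicate k p3 @
       replicate l (midpoint p1 p2) @ replicate m (midpoint p2 p3) @ replicate n (midpoint p3 p1))"

definition S3_list :: "plane \<Rightarrow> plane \<Rightarrow> plane \<Rightarrow> plane \<Rightarrow> real list" where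
  "S3_list p1 p2 p3 x = (let Q = (\<lambda>i j k l m n. Q12 p1 p2 p3 i j k l m n x) in
    [1/4 * Q 4 0 0 1 0 1,
     1/2 * Q 3 1 0 1 0 1,
           Q 2 2 1 1 0 0,
     1/2 * Q 1 3 0 1 1 0,
     1/4 * Q 0 4 0 1 1 0,
     1/2 * Q 0 3 1 1 1 0,
           Q 1 2 2 0 1 0,
     1/2 * Q 0 1 3 0 1 1,
     1/4 * Q 0 0 4 0 1 1,
     1/2 * Q 1 0 3 0 1 1,
           Q 2 1 2 0 0 1,
     1/2 * Q 3 0 1 1 0 1,
           Q 2 1 1 1 0 1,
           Q 1 2 1 1 1 0,
           Q 1 1 2 0 1 1,
     1/4 * Q 1 1 1 1 1 1])"

text \<open>Both the basis functions and the reordering are indexed by \<open>1, \<dots>, 16\<close>.\<close>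

definition S3 :: "plane \<Rightarrow> plane \<Rightarrow> plane \<Rightarrow> nat \<Rightarrow> plane \<Rightarrow> real" where
  "S3 p1 p2 p3 j x = S3_list p1 p2 p3 x ! (j - 1)"

definition reorder :: "nat \<Rightarrow> nat" where
  "reorder i = [1, 2, 3, 4, 5, 12, 13, 14, 6, 11, 16, 7, 15, 10, 8, 9] ! (i - 1)"

definition affine_map :: "(plane \<Rightarrow> plane) \<Rightarrow> bool" where
  "affine_map A \<longleftrightarrow> (\<exists>L b. linear L \<and> A = (\<lambda>x. L x + b))"

text \<open>Iterated partial derivatives taken from within \<open>T\<close>. If \<open>T\<close> is a nondegenerate triangle,
  a derivative within \<open>T\<close> is unique at every point of \<open>T\<close>, vertices included, even when a
  coordinate direction does not point into \<open>T\<close> there.\<close>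

primrec partials_within :: "plane set \<Rightarrow> 2 list \<Rightarrow> (plane \<Rightarrow> real) \<Rightarrow> plane \<Rightarrow> real" where
  "partials_within T [] f = f"
| "partials_within T (i # is) f =
    (\<lambda>x. frechet_derivative (partials_within T is f) (at x within T) (axis i 1))"

text \<open>As \<^const>\<open>frechet_derivative\<close> is total, existence of the partial derivatives has to be
  required separately. It is required on a neighbourhood of \<open>e\<close> relative to \<open>T\<close>, because
  derivatives on \<open>e\<close> of order greater than one involve lower derivatives near \<open>e\<close>.\<close>

definition partials_exist_along :: "nat \<Rightarrow> plane set \<Rightarrow> plane set \<Rightarrow> (plane \<Rightarrow> real) \<Rightarrow> bool" where
  "partials_exist_along r e T f \<longleftrightarrow>
    (\<exists>U. open U \<and> e \<subseteq> U \<and>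
      (\<forall>is. length is < r \<longrightarrow>
        (\<forall>x \<in> T \<inter> U. partials_within T is f differentiable (at x within T))))"

definition meet_smoothly ::
  "nat \<Rightarrow> plane set \<Rightarrow> plane set \<Rightarrow> (plane \<Rightarrow> real) \<Rightarrow> plane set \<Rightarrow> (plane \<Rightarrow> real) \<Rightarrow> bool" where
  "meet_smoothly r e T f T' g \<longleftrightarrow>
    partials_exist_along r e T f \<and> partials_exist_along r e T' g \<and>
    (\<forall>is. length is \<le> r \<longrightarrow>
      (\<forall>x \<in> e. partials_within T is f x = partials_within T' is g x))"

end

theory Submission
  imports Defs
begin

text \<open>Eliminating three barycentric coordinates turns the fibre volume of a lifted simplex into the
  volume of an explicit polytope in \<open>\<real>\<^sup>3\<close>. For each of the five knot patterns of the basis this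
  volume is, in the barycentric coordinates \<open>(a, b, w)\<close> of the triangle, a cubic polynomial plus a
  combination of truncated cubes \<open>max 0 \<ell> ^ 3\<close>, one for each interior line \<open>\<ell> = 0\<close> of the 12-split.
  So \<open>F\<close> and \<open>F'\<close> extend to \<open>C\<^sup>2\<close> functions on the whole plane, derivatives from within a triangle
  are those of the extension, and it suffices to compare derivatives in the two directions
  \<open>p2 - p1\<close> and \<open>p3' - p1\<close>. Along the edge these are splines in one variable \<open>t\<close>; their values at
  \<open>t = 0, 1/4, 1/2, 3/4, 1\<close> force the stated equations, and the equations make them coincide
  for all \<open>t\<close>.\<close>

section \<open>Fibre volumes of lifted simplices\<close>

text \<open>The equations separate by order because of how the basis vanishes on the edge
  \<open>w = 0\<close>. After the reordering, coefficients 1 to 5 belong to the functions that are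
  not identically zero there, 6 to 9 to functions whose first derivatives survive, 10 to 12 to
  functions whose second derivatives survive, and 13 to 16 to functions with zero 2-jet on the edge.
  The interior lines of the 12-split meet the open edge only at its midpoint, so value, first and
  second derivatives along the edge are splines of degree 3, 2 and 1 with the single knot 1/2. With
  the smoothness at the knot inherited from C^2, such splines form spaces of dimension 5, 4 and 3:
  exactly the numbers of new equations. Differentiating along the edge an identity that already
  holds there brings nothing new, so at each order only the purely transversal derivative
  does.\<close>

lemma emeasure_lborel_compact:
  fixes S :: "'a::euclidean_space set"
  assumes "compact S"
  shows "emeasure lborel S = ennreal (measure lebesgue S)"
proof -
  have "S \<in> sets lborel"
    using assms by (simp add: borel_compact)
  then have "emeasure lborel S = emeasure lebesgue S"
    by simp
  also have "\<dots> = ennreal (measure lebesgue S)"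
    using assms by (intro emeasure_eq_measure2 lmeasurable_compact)
  finally show ?thesis .
qed

text \<open>The fibres enter Tonelli integrals as extended values, while the determinant formula
  concerns real-valued measures; compactness makes the two agree.\<close>

lemma emeasure_affine_image:
  fixes f :: "real ^ 'n::{finite,wellorder} \<Rightarrow> real ^ 'n::_"
  assumes "linear f" "compact S"
  shows "emeasure lborel ((+) a ` f ` S) = ennreal \<bar>det (matrix f)\<bar> * emeasure lborel S"
proof -
  have cfS: "compact (f ` S)"
    using assms by (meson compact_continuous_image linear_continuous_on linear_conv_bounded_linear)
  then have c2: "compact ((+) a ` f ` S)"
    by (rule compact_translation)
  have lS: "S \<in> lmeasurable" "(+) a ` f ` S \<in> lmeasurable"
    using lmeasurable_compact[OF assms(2)] lmeasurable_compact[OF c2] by auto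
  have "measure lebesgue ((+) a ` f ` S) = measure lebesgue (f ` S)"
    by (rule measure_translation)
  also have "\<dots> = \<bar>det (matrix f)\<bar> * measure lebesgue S"
    by (rule measure_linear_image[OF assms(1) lS(1)])
  finally show ?thesis
    by (simp add: emeasure_lborel_compact[OF c2] emeasure_lborel_compact[OF assms(2)] ennreal_mult)
qed

section \<open>Affine independence in terms of weights on list positions\<close>

lemma distinct_affine_independentD:
  fixes vs :: "'a::real_vector list"
  assumes "distinct vs" "\<not> affine_dependent (set vs)"
    and "(\<Sum>i<length vs. a i) = 0" "(\<Sum>i<length vs. a i *\<^sub>R vs ! i) = 0" "i < length vs"
  shows "a i = 0"
proof (rule ccontr)
  assume ai: "a i \<noteq> 0"
  \<comment> \<open>Distinctness makes positions and points correspond, so a weight on positions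
    becomes a weight on points.\<close>
  define U where "U v = a (inv_into {..<length vs} ((!) vs) v)" for v
  have bij: "bij_betw ((!) vs) {..<length vs} (set vs)"
    using assms(1) by (simp add: bij_betw_nth)
  then have U: "U (vs ! j) = a j" if "j < length vs" for j
    using that by (auto simp: U_def bij_betw_def inv_into_f_f)
  have "sum U (set vs) = (\<Sum>i<length vs. a i)"
    unfolding sum.reindex_bij_betw[OF bij, symmetric] by (intro sum.cong) (auto simp: U)
  moreover have "(\<Sum>v\<in>set vs. U v *\<^sub>R v) = (\<Sum>i<length vs. a i *\<^sub>R vs ! i)"
    unfolding sum.reindex_bij_betw[OF bij, symmetric] by (intro sum.cong) (auto simp: U)
  moreover have "U (vs ! i) \<noteq> 0" "vs ! i \<in> set vs"
    using ai assms(5) U by auto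
  ultimately have "affine_dependent (set vs)"
    using assms(3,4) unfolding affine_dependent_explicit_finite[OF finite_set]
    by (intro exI[of _ U] conjI bexI[of _ "vs ! i"]) auto
  then show False
    using assms(2) by simp
qed

lemma affine_independent_if_coeffs:
  fixes vs :: "'a::real_vector list"
  assumes *: "\<And>a i. (\<Sum>i<length vs. a i) = 0 \<Longrightarrow> (\<Sum>i<length vs. a i *\<^sub>R vs ! i) = 0
                \<Longrightarrow> i < length vs \<Longrightarrow> a i = (0::real)"
  shows "distinct vs \<and> \<not> affine_dependent (set vs)"
proof
  show d: "distinct vs"
  proof (rule ccontr)
    assume "\<not> distinct vs"
    then obtain i j where ij: "i < length vs" "j < length vs" "i \<noteq> j" "vs ! i = vs ! j"
      by (auto simp: distinct_conv_nth)
    \<comment> \<open>Weights 1 and -1 on two equal entries would be a nontrivial relation.\<close>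
    define a :: "nat \<Rightarrow> real" where "a k = (if k = i then 1 else 0) - (if k = j then 1 else 0)" for k
    have "(\<Sum>k<length vs. a k) = 0"
      using ij by (simp add: a_def sum_subtractf)
    moreover have "(\<Sum>k<length vs. a k *\<^sub>R vs ! k) = 0"
      using ij by (simp add: a_def scaleR_left_diff_distrib sum_subtractf if_distrib[of "\<lambda>z. z *\<^sub>R _"] cong: if_cong)
    ultimately have "a i = 0"
      using ij(1) by (rule *)
    then show False
      using ij by (simp add: a_def)
  qed
  have bij: "bij_betw ((!) vs) {..<length vs} (set vs)"
    using d by (simp add: bij_betw_nth)
  show "\<not> affine_dependent (set vs)"
  proof
    assume "affine_dependent (set vs)"
    then obtain U v where U: "sum U (set vs) = 0" "v \<in> set vs" "U v \<noteq> 0" "(\<Sum>v\<in>set vs. U v *\<^sub>R v) = 0"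
      unfolding affine_dependent_explicit_finite[OF finite_set] by blast
    obtain i where i: "i < length vs" "v = vs ! i"
      using U(2) by (auto simp: in_set_conv_nth)
    have "U (vs ! i) = 0"
      using U(1,4) i(1) unfolding sum.reindex_bij_betw[OF bij, symmetric] by (rule *)
    then show False
      using U i by simp
  qed
qed

text \<open>Permuting knots together with their lifts leaves the simplex unchanged. Hence any three
  affinely independent knots may be moved to the front, in whatever order the spline lists
  them.\<close>

lemma lifted_simplex_mset:
  assumes "lifted_simplex ks vs" "mset ks = mset ks'"
  shows "\<exists>vs'. lifted_simplex ks' vs' \<and> mset vs' = mset vs"
proof -
  obtain p where p: "p permutes {..<length ks}" "permute_list p ks = ks'"
    using mset_eq_permutation[OF assms(2)[symmetric]] by blast
  have ks: "map fst vs = ks"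
    using assms(1) by (simp add: lifted_simplex_def)
  then have p': "p permutes {..<length vs}"
    using p(1) by (metis length_map)
  have vs': "map fst (permute_list p vs) = ks'" "mset (permute_list p vs) = mset vs"
    using permute_list_map[OF p', of fst] p(2) p' ks by auto
  then have "set (permute_list p vs) = set vs" "distinct (permute_list p vs) = distinct vs"
    using mset_eq_setD[OF vs'(2)] mset_eq_imp_distinct_iff[OF vs'(2)] by auto
  with vs' assms(1) show ?thesis
    unfolding lifted_simplex_def by (intro exI[of _ "permute_list p vs"]) simp
qed

section \<open>Coordinates on the standard 5-simplex\<close>

lemma Basis_cart: "(Basis :: (real ^ 'n) set) = range (\<lambda>i. axis i 1)"
  by (auto simp: Basis_vec_def)

lemma sum_Basis_cart: "(\<Sum>b\<in>Basis. f b) = (\<Sum>i\<in>UNIV. f (axis i 1))"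
  for f :: "real ^ 'n \<Rightarrow> 'b::comm_monoid_add"
proof -
  have "inj (\<lambda>i::'n. axis i (1::real))"
    by (auto simp: inj_on_def axis_eq_axis)
  then show ?thesis
    by (simp add: Basis_cart sum.reindex)
qed

lemma sum_Basis_prod: "(\<Sum>b\<in>Basis. f b) = (\<Sum>b\<in>Basis. f (b, 0)) + (\<Sum>b\<in>Basis. f (0, b))"
  for f :: "'a::euclidean_space \<times> 'b::euclidean_space \<Rightarrow> 'c::comm_monoid_add"
proof -
  have "inj_on (\<lambda>u. (u, 0 :: 'b)) (Basis :: 'a set)" "inj_on (\<lambda>u. (0 :: 'a, u)) (Basis :: 'b set)"
    "(\<lambda>u. (u, 0)) ` (Basis :: 'a set) \<inter> (\<lambda>u. (0, u)) ` (Basis :: 'b set) = {}"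
    by (auto intro!: inj_onI)
  then show ?thesis
    by (simp add: Basis_prod_def sum.union_disjoint sum.reindex o_def)
qed

abbreviation std_simplex5 :: "space5 set" where
  "std_simplex5 \<equiv> convex hull (insert 0 Basis)"

lemma mem_std_simplex5:
  "(s, m) \<in> std_simplex5 \<longleftrightarrow>
     0 \<le> s $ 1 \<and> 0 \<le> s $ 2 \<and> 0 \<le> m $ 1 \<and> 0 \<le> m $ 2 \<and> 0 \<le> m $ 3 \<and>
     s $ 1 + s $ 2 + m $ 1 + m $ 2 + m $ 3 \<le> 1"
proof -
  have "(\<forall>i\<in>Basis. 0 \<le> (s, m) \<bullet> i) \<longleftrightarrow> (\<forall>i. 0 \<le> s $ i) \<and> (\<forall>i. 0 \<le> m $ i)"
    by (simp add: Basis_prod_def Basis_cart ball_Un inner_axis)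
  then show ?thesis
    by (auto simp: std_simplex sum_Basis_prod sum_Basis_cart inner_axis sum_2 sum_3
        forall_2 forall_3 algebra_simps)
qed

text \<open>With the first vertex as origin the simplex is the image of the standard simplex under a
  linear map \<open>L\<close> whose plane component is \<open>D (s + E m)\<close>, where
  \<open>E\<close> holds the plane coordinates of the last three knots. Fixing the base point fixes
  \<open>s = t - E m\<close>, and what remains depends affinely on \<open>m\<close>, with a linear
  part \<open>H\<close> that is the same for every fibre.\<close>

lemma lifted_fibre:
  fixes vs :: "space5 list" and q0 q1 q2 :: plane and a b :: "real ^ 3"
  defines "D \<equiv> (\<lambda>t::real^2. t $ 1 *\<^sub>R (q1 - q0) + t $ 2 *\<^sub>R (q2 - q0))"
    and "E \<equiv> (\<lambda>m::real^3. vector [a \<bullet> m, b \<bullet> m] :: real^2)"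
  assumes lift: "lifted_simplex (q0 # q1 # q2 # map (\<lambda>i. q0 + a $ i *\<^sub>R (q1 - q0) + b $ i *\<^sub>R (q2 - q0)) [1, 2, 3]) vs"
    and inj: "inj D"
  obtains G H where "linear H" "inj H"
    "\<And>t. {y. (q0 + D t, y) \<in> convex hull (set vs)} = (+) (G t) ` H ` {m. (t - E m, m) \<in> std_simplex5}"
proof -
  define r where "r i = q0 + a $ i *\<^sub>R (q1 - q0) + b $ i *\<^sub>R (q2 - q0)" for i
  have fst_vs: "map fst vs = [q0, q1, q2, r 1, r 2, r 3]" and vs: "distinct vs" "\<not> affine_dependent (set vs)"
    using lift by (auto simp: lifted_simplex_def r_def)
  obtain w0 w1 w2 w3 w4 w5 where
    vs_eq: "vs = [(q0, w0), (q1, w1), (q2, w2), (r 1, w3), (r 2, w4), (r 3, w5)]"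
    using fst_vs by (auto simp: map_eq_Cons_conv)
  define W where "W s = s $ 1 *\<^sub>R (w1 - w0) + s $ 2 *\<^sub>R (w2 - w0)" for s :: "real^2"
  define H' where "H' m = m $ 1 *\<^sub>R (w3 - w0) + m $ 2 *\<^sub>R (w4 - w0) + m $ 3 *\<^sub>R (w5 - w0)" for m :: "real^3"
  define H where "H m = H' m - W (E m)" for m
  define L :: "space5 \<Rightarrow> space5" where "L z = (D (fst z + E (snd z)), W (fst z) + H' (snd z))" for z
  have linD: "linear D" and linW: "linear W" and linH': "linear H'"
    unfolding D_def W_def[abs_def] H'_def[abs_def]
    by (auto intro!: linearI simp: algebra_simps)
  have linE: "linear E"
    unfolding E_def by (auto intro!: linearI simp: vec_eq_iff forall_2 inner_simps)
  have linH: "linear H"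
    unfolding H_def[abs_def]
    by (intro linear_compose_sub linH' linear_compose[OF linE linW, unfolded o_def])
  have linL: "linear L"
    unfolding L_def[abs_def]
    by (auto intro!: linearI simp: linear_add[OF linD] linear_add[OF linE] linear_add[OF linW] linear_add[OF linH']
        linear_scale[OF linD] linear_scale[OF linE] linear_scale[OF linW] linear_scale[OF linH'] algebra_simps)
  have D_E: "D (E m) = m $ 1 *\<^sub>R (r 1 - q0) + m $ 2 *\<^sub>R (r 2 - q0) + m $ 3 *\<^sub>R (r 3 - q0)" for m
    by (simp add: D_def E_def r_def inner_vec_def sum_3 algebra_simps)
  have hull: "convex hull (set vs) = (+) (q0, w0) ` L ` std_simplex5"
  proof -
    have Basis5: "(Basis :: space5 set) = {(axis 1 1, 0), (axis 2 1, 0), (0, axis 1 1), (0, axis 2 1), (0, axis 3 1)}"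
      by (auto simp: Basis_prod_def Basis_cart UNIV_2 UNIV_3)
    have LB: "L ` Basis = {(q1 - q0, w1 - w0), (q2 - q0, w2 - w0), (r 1 - q0, w3 - w0), (r 2 - q0, w4 - w0), (r 3 - q0, w5 - w0)}"
      unfolding Basis5
      by (simp add: L_def linear_add[OF linD] D_E linear_0[OF linE] linear_0[OF linD] linear_0[OF linW] linear_0[OF linH'])
        (simp add: D_def W_def H'_def axis_def)
    have "(+) (q0, w0) ` L ` std_simplex5 = convex hull ((+) (q0, w0) ` insert (L 0) (L ` Basis))"
      by (simp add: convex_hull_linear_image[OF linL] convex_hull_translation[symmetric])
    also have "(+) (q0, w0) ` insert (L 0) (L ` Basis) = set vs"
      unfolding LB linear_0[OF linL] by (simp add: vs_eq)
    finally show ?thesis ..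
  qed
  have injH: "inj H"
  proof (subst linear_injective_0[OF linH], intro allI impI)
    fix m assume "H m = 0"
    then have Hm: "H' m = W (E m)"
      by (simp add: H_def)
    define x where "x = E m"
    \<comment> \<open>If \<open>H m = 0\<close>, these weights annihilate the six vertices: the last
      three are cancelled by the vertices over \<open>q1\<close> and \<open>q2\<close> weighted by
      \<open>E m\<close>, and the first entry makes the sum zero.\<close>
    define c where "c = (\<lambda>i. [x $ 1 + x $ 2 - m $ 1 - m $ 2 - m $ 3, - x $ 1, - x $ 2, m $ 1, m $ 2, m $ 3] ! i)"
    have len: "length vs = 6" by (simp add: vs_eq)
    have 1: "sum c {..<length vs} = 0"
      by (simp add: len c_def eval_nat_numeral lessThan_Suc)
    have fst0: "D x = m $ 1 *\<^sub>R (r 1 - q0) + m $ 2 *\<^sub>R (r 2 - q0) + m $ 3 *\<^sub>R (r 3 - q0)"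
      using D_E[of m] by (simp add: x_def)
    have 2: "(\<Sum>i<length vs. c i *\<^sub>R vs ! i) = 0"
    proof (rule prod_eqI)
      show "fst (\<Sum>i<length vs. c i *\<^sub>R vs ! i) = fst (0 :: space5)"
        using fst0 by (simp add: len c_def eval_nat_numeral lessThan_Suc vs_eq D_def algebra_simps)
      show "snd (\<Sum>i<length vs. c i *\<^sub>R vs ! i) = snd (0 :: space5)"
        using Hm by (simp add: len c_def eval_nat_numeral lessThan_Suc vs_eq W_def H'_def x_def algebra_simps)
    qed
    have "c i = 0" if "i < 6" for i
      using distinct_affine_independentD[OF vs 1 2] that len by simp
    from this[of 3] this[of 4] this[of 5] show "m = 0"
      by (simp add: c_def vec_eq_iff forall_3 eval_nat_numeral)
  qed
  have fib: "{y. (q0 + D t, y) \<in> convex hull (set vs)} = (+) (w0 + W t) ` H ` {m. (t - E m, m) \<in> std_simplex5}" for t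
  proof (intro set_eqI iffI)
    fix y assume "y \<in> {y. (q0 + D t, y) \<in> convex hull (set vs)}"
    then obtain s m where sm: "(s, m) \<in> std_simplex5" "q0 + D t = q0 + D (s + E m)" "y = w0 + (W s + H' m)"
      unfolding hull by (auto simp: L_def)
    then have "t = s + E m"
      using inj by (auto dest: injD)
    then have "s = t - E m"
      by simp
    then show "y \<in> (+) (w0 + W t) ` H ` {m. (t - E m, m) \<in> std_simplex5}"
      using sm(1,3) by (auto simp: H_def linear_diff[OF linW] linear_add[OF linW] algebra_simps image_iff intro!: exI[of _ m])
  next
    fix y assume "y \<in> (+) (w0 + W t) ` H ` {m. (t - E m, m) \<in> std_simplex5}"
    then obtain m where m: "(t - E m, m) \<in> std_simplex5" "y = w0 + W t + H m"
      by auto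
    then have "(q0 + D t, y) = (q0, w0) + L (t - E m, m)"
      by (simp add: L_def H_def linear_diff[OF linW])
    then show "y \<in> {y. (q0 + D t, y) \<in> convex hull (set vs)}"
      unfolding hull using m(1) by blast
  qed
  show ?thesis
    by (rule that[OF linH injH fib])
qed

text \<open>Lifting the last three knots by the unit vectors and the others by zero forces the last
  three weights of any relation to vanish, wherever \<open>r\<close> lies; the rest is independence
  of \<open>q0, q1, q2\<close> in the plane.\<close>

lemma lifted_simplex_exists:
  fixes q0 q1 q2 :: plane and r :: "3 \<Rightarrow> plane"
  assumes inj: "inj (\<lambda>t::real^2. t $ 1 *\<^sub>R (q1 - q0) + t $ 2 *\<^sub>R (q2 - q0))"
  shows "\<exists>vs. lifted_simplex (q0 # q1 # q2 # map r [1, 2, 3]) vs"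
proof -
  define vs :: "space5 list"
    where "vs = (q0, 0) # (q1, 0) # (q2, 0) # map (\<lambda>i. (r i, axis i 1)) [1, 2, 3]"
  have "distinct vs \<and> \<not> affine_dependent (set vs)"
  proof (rule affine_independent_if_coeffs)
    fix a :: "nat \<Rightarrow> real" and i
    assume a: "(\<Sum>i<length vs. a i) = 0" "(\<Sum>i<length vs. a i *\<^sub>R vs ! i) = 0" and i: "i < length vs"
    have a': "a 0 + a 1 + a 2 + a 3 + a 4 + a 5 = 0"
      using a(1) by (simp add: vs_def eval_nat_numeral lessThan_Suc)
    have "snd (\<Sum>i<length vs. a i *\<^sub>R vs ! i) $ j = 0" for j
      using a(2) by simp
    from this[of 1] this[of 2] this[of 3] have a345: "a 3 = 0" "a 4 = 0" "a 5 = 0"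
      by (simp_all add: vs_def eval_nat_numeral lessThan_Suc axis_def)
    have "fst (\<Sum>i<length vs. a i *\<^sub>R vs ! i) = 0"
      using a(2) by simp
    then have "a 0 *\<^sub>R q0 + a 1 *\<^sub>R q1 + a 2 *\<^sub>R q2 = 0"
      using a345 by (simp add: vs_def eval_nat_numeral lessThan_Suc algebra_simps)
    moreover have "a 0 = - a 1 - a 2"
      using a' a345 by simp
    ultimately have "a 1 *\<^sub>R (q1 - q0) + a 2 *\<^sub>R (q2 - q0) = 0"
      by (simp add: algebra_simps)
    moreover have lin: "linear (\<lambda>t::real^2. t $ 1 *\<^sub>R (q1 - q0) + t $ 2 *\<^sub>R (q2 - q0))"
      by (auto intro!: linearI simp: algebra_simps)
    moreover have "\<forall>t::real^2. t $ 1 *\<^sub>R (q1 - q0) + t $ 2 *\<^sub>R (q2 - q0) = 0 \<longrightarrow> t = 0"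
      using inj linear_injective_0[OF lin] by blast
    from this[rule_format, of "vector [a 1, a 2]"] calculation have "vector [a 1, a 2] = (0 :: real^2)"
      by simp
    then have "a 1 = 0" "a 2 = 0"
      by (metis vector_2 zero_index)+
    with a' a345 have "a j = 0" if "j \<in> {0, 1, 2, 3, 4, 5}" for j
      using that by auto
    moreover have "i \<in> {0, 1, 2, 3, 4, 5}"
      using i by (auto simp: vs_def)
    ultimately show "a i = 0"
      by blast
  qed
  then have "lifted_simplex (q0 # q1 # q2 # map r [1, 2, 3]) vs"
    by (simp add: lifted_simplex_def vs_def)
  then show ?thesis ..
qed

text \<open>The fibre coordinates contribute the same Jacobian to \<open>vol\<^sub>3\<close> of a fibre and to \<open>vol\<^sub>5\<close> of the
  simplex, so it cancels in the quotient; the constant is \<open>12 = 5! / (5 choose 2)\<close>.\<close>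

lemma simplex_spline_eq:
  fixes q0 q1 q2 :: plane and a b :: "real ^ 3"
  defines "D \<equiv> (\<lambda>t::real^2. t $ 1 *\<^sub>R (q1 - q0) + t $ 2 *\<^sub>R (q2 - q0))"
    and "E \<equiv> (\<lambda>m::real^3. vector [a \<bullet> m, b \<bullet> m] :: real^2)"
  assumes ks: "mset ks = mset (q0 # q1 # q2 # map (\<lambda>i. q0 + a $ i *\<^sub>R (q1 - q0) + b $ i *\<^sub>R (q2 - q0)) [1, 2, 3])"
    and inj: "inj D"
  shows "simplex_spline \<Delta> ks (q0 + D t) =
    12 * measure lborel \<Delta> / \<bar>det (matrix D)\<bar> * measure lborel {m. (t - E m, m) \<in> std_simplex5}"
proof -
  define ks' where "ks' = q0 # q1 # q2 # map (\<lambda>i. q0 + a $ i *\<^sub>R (q1 - q0) + b $ i *\<^sub>R (q2 - q0)) [1, 2, 3]"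
  define ws where "ws = (SOME vs. lifted_simplex ks vs)"
  define \<tau> where "\<tau> = convex hull (set ws)"
  define P where "P t = {m. (t - E m, m) \<in> std_simplex5}" for t
  obtain vs0 where "lifted_simplex ks' vs0"
    using lifted_simplex_exists[OF inj[unfolded D_def]] unfolding ks'_def by blast
  moreover have ks': "mset ks = mset ks'"
    using ks by (simp add: ks'_def)
  ultimately have "\<exists>vs. lifted_simplex ks vs"
    using lifted_simplex_mset[OF _ ks'[symmetric]] by blast
  then have "lifted_simplex ks ws"
    unfolding ws_def by (rule someI_ex)
  then obtain vs where vs: "lifted_simplex ks' vs" "mset vs = mset ws"
    using lifted_simplex_mset[OF _ ks'] by blast
  have \<tau>: "\<tau> = convex hull (set vs)"
    unfolding \<tau>_def using mset_eq_setD[OF vs(2)] by simp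
  have "\<exists>G H. linear H \<and> inj H \<and> (\<forall>t. {y. (q0 + D t, y) \<in> \<tau>} = (+) (G t) ` H ` P t)"
    unfolding \<tau> D_def E_def P_def
    by (rule lifted_fibre[OF vs(1)[unfolded ks'_def] inj[unfolded D_def]]) blast
  then obtain G H where GH: "linear H" "inj H" and
    fib: "\<And>t. {y. (q0 + D t, y) \<in> \<tau>} = (+) (G t) ` H ` P t"
    by blast
  have linD: "linear D"
    unfolding D_def by (auto intro!: linearI simp: algebra_simps)
  have linE: "linear E"
    unfolding E_def by (auto intro!: linearI simp: vec_eq_iff forall_2 inner_simps)
  obtain D' where D': "linear D'" "\<And>x. D' (D x) = x" "\<And>x. D (D' x) = x"
    using linear_injective_isomorphism[OF linD inj] by auto
  have cE: "continuous_on UNIV E" and cD': "continuous_on UNIV D'"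
    using linE D'(1) by (simp_all add: linear_continuous_on linear_conv_bounded_linear)
  have [continuous_intros]: "continuous_on S (\<lambda>x. E (f x))" if "continuous_on S f" for S and f :: "'c::topological_space \<Rightarrow> real^3"
    using continuous_on_compose2[OF cE that] by simp
  have [continuous_intros]: "continuous_on S (\<lambda>x. D' (f x))" if "continuous_on S f" for S and f :: "'c::topological_space \<Rightarrow> plane"
    using continuous_on_compose2[OF cD' that] by simp
  have cstd: "compact std_simplex5"
    by (intro finite_imp_compact_convex_hull) auto
  have bstd: "0 \<le> m $ i \<and> m $ i \<le> 1" if "(s, m) \<in> std_simplex5" for s m i
    using that exhaust_3[of i] unfolding mem_std_simplex5 by auto
  have compP: "compact (P t)" for t
  proof -
    have "closed (P t)"
      unfolding P_def vimage_def[of _ std_simplex5, symmetric]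
      by (intro closed_vimage compact_imp_closed cstd continuous_intros)
    moreover have "P t \<subseteq> cbox 0 1"
      using bstd by (auto simp: P_def mem_box_cart)
    ultimately show ?thesis
      unfolding compact_eq_bounded_closed using bounded_subset[OF bounded_cbox] by blast
  qed
  have comps: "compact {s. (s, m) \<in> std_simplex5}" for m
  proof -
    have "closed {s. (s, m) \<in> std_simplex5}"
      unfolding vimage_def[of _ std_simplex5, symmetric]
      by (intro closed_vimage compact_imp_closed cstd continuous_intros)
    moreover have "{s. (s, m) \<in> std_simplex5} \<subseteq> cbox 0 1"
      by (auto simp: mem_std_simplex5 mem_box_cart forall_2)
    ultimately show ?thesis
      unfolding compact_eq_bounded_closed using bounded_subset[OF bounded_cbox] by blast
  qed
  define h where "h = \<bar>det (matrix H)\<bar>"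
  define d where "d = \<bar>det (matrix D)\<bar>"
  have hpos: "h > 0" and dpos: "d > 0"
    using GH linD inj det_nz_iff_inj unfolding h_def d_def by auto
  have fibm: "emeasure lborel {y. (q0 + D t, y) \<in> \<tau>} = ennreal h * emeasure lborel (P t)" for t
    unfolding fib h_def by (rule emeasure_affine_image[OF GH(1) compP])
  \<comment> \<open>\<open>S\<close> is the simplex with its fibre coordinate \<open>y\<close>
    replaced by \<open>m\<close>. Slicing it over \<open>x\<close> compares it with \<tau> and
    produces the factor \<open>h\<close>; slicing it over \<open>m\<close> gives translated images
    under \<open>D\<close> of slices of the standard simplex and produces the factor
    \<open>d\<close>.\<close>
  define S where "S = {(x, m). (D' (x - q0) - E m, m) \<in> std_simplex5}"
  have stds: "std_simplex5 \<in> sets (lborel \<Otimes>\<^sub>M lborel)"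
    unfolding lborel_prod using cstd by (simp add: borel_compact)
  have "closed ((\<lambda>z. (D' (fst z - q0) - E (snd z), snd z)) -` std_simplex5)"
    by (intro closed_vimage compact_imp_closed cstd continuous_intros)
  also have "(\<lambda>z. (D' (fst z - q0) - E (snd z), snd z)) -` std_simplex5 = S"
    by (auto simp: S_def)
  finally have S: "S \<in> sets (lborel \<Otimes>\<^sub>M lborel)"
    unfolding lborel_prod by (simp add: borel_closed)
  have "emeasure lborel \<tau> = (\<integral>\<^sup>+x. emeasure lborel (Pair x -` \<tau>) \<partial>lborel)"
  proof -
    have "\<tau> \<in> sets (lborel \<Otimes>\<^sub>M lborel)"
      unfolding lborel_prod \<tau> by (simp add: borel_compact finite_imp_compact_convex_hull)
    from lborel.emeasure_pair_measure_alt[OF this] show ?thesis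
      by (simp add: lborel_prod)
  qed
  also have "\<dots> = (\<integral>\<^sup>+x. ennreal h * emeasure lborel (P (D' (x - q0))) \<partial>lborel)"
    using fibm[of "D' (_ - q0)"] by (intro nn_integral_cong) (simp add: D' vimage_def)
  also have "\<dots> = (\<integral>\<^sup>+x. ennreal h * emeasure lborel (Pair x -` S) \<partial>lborel)"
    by (simp add: P_def S_def vimage_def)
  also have "\<dots> = ennreal h * (\<integral>\<^sup>+x. emeasure lborel (Pair x -` S) \<partial>lborel)"
    using lborel.measurable_emeasure_Pair[OF S] by (intro nn_integral_cmult) simp
  also have "(\<integral>\<^sup>+x. emeasure lborel (Pair x -` S) \<partial>lborel) = emeasure (lborel \<Otimes>\<^sub>M lborel) S"
    by (rule lborel.emeasure_pair_measure_alt[OF S, symmetric])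
  also have "\<dots> = (\<integral>\<^sup>+m. emeasure lborel ((\<lambda>x. (x, m)) -` S) \<partial>lborel)"
    by (rule lborel_pair.emeasure_pair_measure_alt2[OF S])
  also have "\<dots> = (\<integral>\<^sup>+m. ennreal d * emeasure lborel ((\<lambda>s. (s, m)) -` std_simplex5) \<partial>lborel)"
  proof (rule nn_integral_cong)
    fix m
    have "(\<lambda>x. (x, m)) -` S = (+) (q0 + D (E m)) ` D ` {s. (s, m) \<in> std_simplex5}"
    proof (intro set_eqI iffI)
      fix x assume "x \<in> (\<lambda>x. (x, m)) -` S"
      moreover have "x = q0 + D (E m) + D (D' (x - q0) - E m)"
        by (simp add: linear_diff[OF linD] D')
      ultimately show "x \<in> (+) (q0 + D (E m)) ` D ` {s. (s, m) \<in> std_simplex5}"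
        unfolding S_def by blast
    next
      fix x assume "x \<in> (+) (q0 + D (E m)) ` D ` {s. (s, m) \<in> std_simplex5}"
      then obtain s where s: "(s, m) \<in> std_simplex5" "x = q0 + D (E m) + D s"
        by auto
      then have "D' (x - q0) = E m + s"
        by (simp add: linear_add[OF D'(1)] D')
      then show "x \<in> (\<lambda>x. (x, m)) -` S"
        using s by (simp add: S_def)
    qed
    then show "emeasure lborel ((\<lambda>x. (x, m)) -` S) = ennreal d * emeasure lborel ((\<lambda>s. (s, m)) -` std_simplex5)"
      using emeasure_affine_image[OF linD comps] by (simp add: d_def vimage_def)
  qed
  also have "\<dots> = ennreal d * (\<integral>\<^sup>+m. emeasure lborel ((\<lambda>s. (s, m)) -` std_simplex5) \<partial>lborel)"
    using lborel_pair.measurable_emeasure_Pair2[OF stds] by (intro nn_integral_cmult) simp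
  also have "(\<integral>\<^sup>+m. emeasure lborel ((\<lambda>s. (s, m)) -` std_simplex5) \<partial>lborel) = emeasure (lborel \<Otimes>\<^sub>M lborel) std_simplex5"
    by (rule lborel_pair.emeasure_pair_measure_alt2[OF stds, symmetric])
  also have "\<dots> = ennreal (1 / 120)"
    by (simp add: lborel_prod emeasure_std_simplex fact_numeral)
  finally have "emeasure lborel \<tau> = ennreal (h * (d * (1 / 120)))"
    using hpos dpos by (simp add: ennreal_mult[symmetric])
  then have m\<tau>: "measure lborel \<tau> = h * d / 120"
    using hpos dpos by (simp add: measure_def)
  have mf: "measure lborel {y. (q0 + D t, y) \<in> \<tau>} = h * measure lborel (P t)"
    using fibm[of t] hpos by (simp add: measure_def enn2real_mult)
  have choose: "real (5 choose 2) = 10"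
    by (simp add: eval_nat_numeral)
  have "simplex_spline \<Delta> ks (q0 + D t) = measure lborel \<Delta> / 10 * (h * measure lborel (P t) / (h * d / 120))"
    unfolding simplex_spline_def Let_def ws_def[symmetric] \<tau>_def[symmetric] mf m\<tau> choose ..
  also have "\<dots> = 12 * measure lborel \<Delta> / d * measure lborel (P t)"
    using hpos dpos by simp
  finally show ?thesis
    by (simp add: d_def P_def)
qed

section \<open>Lebesgue measure on \<open>real ^ 3\<close> via triples of reals\<close>

lemma prod_Basis_cart: "(\<Prod>b\<in>Basis. f b) = (\<Prod>i\<in>UNIV. f (axis i 1))"
  for f :: "real ^ 'n \<Rightarrow> 'b::comm_monoid_mult"
proof -
  have "inj (\<lambda>i::'n. axis i (1::real))"
    by (auto simp: inj_on_def axis_eq_axis)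
  then show ?thesis
    by (simp add: Basis_cart prod.reindex)
qed

lemma prod_Basis_prod: "(\<Prod>b\<in>Basis. f b) = (\<Prod>b\<in>Basis. f (b, 0)) * (\<Prod>b\<in>Basis. f (0, b))"
  for f :: "'a::euclidean_space \<times> 'b::euclidean_space \<Rightarrow> 'c::comm_monoid_mult"
proof -
  have "inj_on (\<lambda>u. (u, 0 :: 'b)) (Basis :: 'a set)" "inj_on (\<lambda>u. (0 :: 'a, u)) (Basis :: 'b set)"
    "(\<lambda>u. (u, 0)) ` (Basis :: 'a set) \<inter> (\<lambda>u. (0, u)) ` (Basis :: 'b set) = {}"
    by (auto intro!: inj_onI)
  then show ?thesis
    by (simp add: Basis_prod_def prod.union_disjoint prod.reindex o_def)
qed

lemma borel_measurable_vector3: "(\<lambda>(x, y, z). vector [x, y, z] :: real ^ 3) \<in> borel \<rightarrow>\<^sub>M borel"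
proof (rule borel_measurable_continuous_onI)
  have "linear (\<lambda>(x, y, z). vector [x, y, z] :: real ^ 3)"
    by (auto intro!: linearI simp: vec_eq_iff forall_3)
  then show "continuous_on UNIV (\<lambda>(x, y, z). vector [x, y, z] :: real ^ 3)"
    by (simp add: linear_continuous_on linear_conv_bounded_linear)
qed

text \<open>Lebesgue measure is determined by its values on boxes, and the map from triples pulls a
  box back to a box with the same sides. On triples, volumes can be computed by slicing one
  coordinate at a time.\<close>

lemma lborel_cart3:
  "(lborel :: (real ^ 3) measure) = distr lborel borel (\<lambda>(x, y, z). vector [x, y, z])"
proof (rule lborel_eqI)
  let ?J = "\<lambda>(x, y, z). vector [x, y, z] :: real ^ 3"
  note J = borel_measurable_vector3
  fix l u :: "real ^ 3"
  assume lu: "\<And>b. b \<in> Basis \<Longrightarrow> l \<bullet> b \<le> u \<bullet> b"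
  have "?J -` box l u = box (l $ 1, l $ 2, l $ 3) (u $ 1, u $ 2, u $ 3)"
    by (auto simp: mem_box_cart forall_3 mem_box[where 'a="real \<times> real \<times> real"] Basis_prod_def)
  moreover have le: "l $ i \<le> u $ i" for i
    using lu[of "axis i 1"] by (simp add: inner_axis Basis_cart)
  moreover have all: "\<forall>b\<in>Basis. (l $ 1, l $ 2, l $ 3) \<bullet> b \<le> (u $ 1, u $ 2, u $ 3) \<bullet> b"
    using le by (simp add: Basis_prod_def ball_Un)
  moreover have "emeasure (distr lborel borel ?J) (box l u) = emeasure lborel (?J -` box l u \<inter> space lborel)"
    using J by (intro emeasure_distr) auto
  moreover have "emeasure lborel (box (l $ 1, l $ 2, l $ 3) (u $ 1, u $ 2, u $ 3)) =
      ennreal (\<Prod>b\<in>Basis. ((u $ 1, u $ 2, u $ 3) - (l $ 1, l $ 2, l $ 3)) \<bullet> b)"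
    by (subst emeasure_lborel_box_eq, subst if_P, rule all, rule refl)
  ultimately have "emeasure (distr lborel borel ?J) (box l u) =
      ennreal (\<Prod>b\<in>Basis. ((u $ 1, u $ 2, u $ 3) - (l $ 1, l $ 2, l $ 3)) \<bullet> b)"
    by (simp only: space_lborel space_borel Int_UNIV_right)
  also have "(\<Prod>b\<in>Basis. ((u $ 1, u $ 2, u $ 3) - (l $ 1, l $ 2, l $ 3)) \<bullet> b) = (\<Prod>b\<in>Basis. (u - l) \<bullet> b)"
    unfolding prod_Basis_prod prod_Basis_cart UNIV_3 by (simp add: inner_axis)
  finally show "emeasure (distr lborel borel ?J) (box l u) = (\<Prod>b\<in>Basis. (u - l) \<bullet> b)" .
qed simp

lemma measure_cart3:
  assumes "{v :: real ^ 3. R (v $ 1) (v $ 2) (v $ 3)} \<in> sets borel"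
  shows "measure lborel {v :: real ^ 3. R (v $ 1) (v $ 2) (v $ 3)} = measure lborel {(x, y, z). R x y z}"
proof -
  have "measure (distr lborel borel (\<lambda>(x, y, z). vector [x, y, z] :: real ^ 3)) {v :: real ^ 3. R (v $ 1) (v $ 2) (v $ 3)} =
      measure lborel ((\<lambda>(x, y, z). vector [x, y, z]) -` {v :: real ^ 3. R (v $ 1) (v $ 2) (v $ 3)} \<inter> space lborel)"
    using borel_measurable_vector3 by (intro measure_distr assms) simp
  also have "(\<lambda>(x, y, z). vector [x, y, z]) -` {v :: real ^ 3. R (v $ 1) (v $ 2) (v $ 3)} \<inter> space lborel = {(x, y, z). R x y z}"
    by auto
  finally show ?thesis
    unfolding lborel_cart3[symmetric] .
qed

text \<open>Twice the signed area of the triangle, which is also the determinant of the coordinate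
  map \<open>D\<close>.\<close>

definition jac :: "plane \<Rightarrow> plane \<Rightarrow> plane \<Rightarrow> real" where
  "jac q0 q1 q2 = (q1 $ 1 - q0 $ 1) * (q2 $ 2 - q0 $ 2) - (q1 $ 2 - q0 $ 2) * (q2 $ 1 - q0 $ 1)"

definition pt :: "plane \<Rightarrow> plane \<Rightarrow> plane \<Rightarrow> real \<Rightarrow> real \<Rightarrow> plane" where
  "pt q0 q1 q2 s t = q0 + s *\<^sub>R (q1 - q0) + t *\<^sub>R (q2 - q0)"

lemma pt_inj:
  assumes "jac q0 q1 q2 \<noteq> 0" "pt q0 q1 q2 s t = pt q0 q1 q2 s' t'"
  shows "s = s'" "t = t'"
proof -
  have "(s - s') * (q1 $ i - q0 $ i) + (t - t') * (q2 $ i - q0 $ i) = 0" for i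
    using arg_cong[OF assms(2), of "\<lambda>v. v $ i"] by (simp add: pt_def algebra_simps)
  \<comment> \<open>Cramer's rule: eliminating either unknown leaves a multiple of
    \<open>jac\<close>.\<close>
  from this[of 1] this[of 2] have "(s - s') * jac q0 q1 q2 = 0" "(t - t') * jac q0 q1 q2 = 0"
    unfolding jac_def by algebra+
  then show "s = s'" "t = t'"
    using assms(1) by auto
qed

text \<open>The six inequalities say that the barycentric coordinates of a point of the lifted
  simplex are nonnegative: \<open>x, y, z\<close> are the weights of the last three knots, and the
  other three inequalities concern the weights of \<open>q1\<close>, \<open>q2\<close> and
  \<open>q0\<close>, in this order.\<close>

lemma simplex_spline_pt:
  fixes q0 q1 q2 :: plane
  assumes ks: "mset ks = {#q0, q1, q2, pt q0 q1 q2 a1 b1, pt q0 q1 q2 a2 b2, pt q0 q1 q2 a3 b3#}"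
    and nz: "jac q0 q1 q2 \<noteq> 0"
  shows "simplex_spline \<Delta> ks (pt q0 q1 q2 s t) = 12 * measure lborel \<Delta> / \<bar>jac q0 q1 q2\<bar> *
    measure lborel {(x, y, z). 0 \<le> x \<and> 0 \<le> y \<and> 0 \<le> z \<and>
      a1 * x + a2 * y + a3 * z \<le> s \<and> b1 * x + b2 * y + b3 * z \<le> t \<and>
      (1 - a1 - b1) * x + (1 - a2 - b2) * y + (1 - a3 - b3) * z \<le> 1 - s - t}"
proof -
  define a b :: "real ^ 3" where "a = vector [a1, a2, a3]" and "b = vector [b1, b2, b3]"
  define D where "D = (\<lambda>t::real^2. t $ 1 *\<^sub>R (q1 - q0) + t $ 2 *\<^sub>R (q2 - q0))"
  define v :: "real^2" where "v = vector [s, t]"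
  have inj: "inj D"
  proof (rule injI)
    fix u w assume "D u = D w"
    then have "pt q0 q1 q2 (u $ 1) (u $ 2) = pt q0 q1 q2 (w $ 1) (w $ 2)"
      by (simp add: D_def pt_def add.assoc)
    from pt_inj[OF nz this] show "u = w"
      by (simp add: vec_eq_iff forall_2)
  qed
  have det: "det (matrix D) = jac q0 q1 q2"
    by (simp add: det_2 matrix_def D_def jac_def axis_def algebra_simps)
  have ks': "mset ks = mset (q0 # q1 # q2 # map (\<lambda>i. q0 + a $ i *\<^sub>R (q1 - q0) + b $ i *\<^sub>R (q2 - q0)) [1, 2, 3])"
    using ks by (simp add: pt_def a_def b_def)
  have ptD: "pt q0 q1 q2 s t = q0 + D v"
    by (simp add: D_def v_def pt_def add.assoc)
  let ?R = "\<lambda>x y z. 0 \<le> x \<and> 0 \<le> y \<and> 0 \<le> z \<and>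
      a1 * x + a2 * y + a3 * z \<le> s \<and> b1 * x + b2 * y + b3 * z \<le> t \<and>
      (1 - a1 - b1) * x + (1 - a2 - b2) * y + (1 - a3 - b3) * z \<le> 1 - s - t"
  have eq: "{m. (v - vector [a \<bullet> m, b \<bullet> m], m) \<in> std_simplex5} = {m. ?R (m $ 1) (m $ 2) (m $ 3)}"
    by (auto simp: mem_std_simplex5 v_def a_def b_def inner_vec_def sum_3 algebra_simps)
  have "closed {m :: real^3. ?R (m $ 1) (m $ 2) (m $ 3)}"
    by (intro closed_Collect_conj closed_Collect_le continuous_intros)
  then have "measure lborel {m :: real^3. ?R (m $ 1) (m $ 2) (m $ 3)} = measure lborel {(x, y, z). ?R x y z}"
    by (intro measure_cart3) (simp add: borel_closed)
  moreover have "simplex_spline \<Delta> ks (q0 + D v) = 12 * measure lborel \<Delta> / \<bar>det (matrix D)\<bar> *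
      measure lborel {m. (v - vector [a \<bullet> m, b \<bullet> m], m) \<in> std_simplex5}"
    unfolding D_def by (rule simplex_spline_eq[OF ks' inj[unfolded D_def]])
  ultimately show ?thesis
    unfolding ptD det eq by (simp only:)
qed

section \<open>Truncated powers and polytope volumes\<close>

text \<open>Cavalieri's principle followed by the fundamental theorem of calculus, with
  \<open>F\<close> an antiderivative of the section size. The extended value is kept because a
  section may itself be measured this way.\<close>

lemma emeasure_Icc_sections:
  fixes S :: "(real \<times> 'a::euclidean_space) set"
  assumes "closed S" "f \<in> borel_measurable borel" "a \<le> b"
    and F: "\<And>x. a \<le> x \<Longrightarrow> x \<le> b \<Longrightarrow> (F has_real_derivative f x) (at x)"
    and f: "\<And>x. a \<le> x \<Longrightarrow> x \<le> b \<Longrightarrow> 0 \<le> f x"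
    and S: "\<And>x y. (x, y) \<in> S \<Longrightarrow> a \<le> x \<and> x \<le> b"
    and sec: "\<And>x. a \<le> x \<Longrightarrow> x \<le> b \<Longrightarrow> emeasure lborel {y. (x, y) \<in> S} = ennreal (f x)"
  shows "emeasure lborel S = ennreal (F b - F a)" "measure lborel S = F b - F a"
proof -
  have "S \<in> sets (lborel \<Otimes>\<^sub>M lborel)"
    unfolding lborel_prod using assms(1) by (simp add: borel_closed)
  then have "emeasure (lborel \<Otimes>\<^sub>M lborel) S = (\<integral>\<^sup>+x. emeasure lborel (Pair x -` S) \<partial>lborel)"
    by (rule lborel.emeasure_pair_measure_alt)
  also have "\<dots> = (\<integral>\<^sup>+x. ennreal (f x) * indicator {a .. b} x \<partial>lborel)"
  proof (rule nn_integral_cong)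
    fix x
    show "emeasure lborel (Pair x -` S) = ennreal (f x) * indicator {a .. b} x"
    proof (cases "a \<le> x \<and> x \<le> b")
      case True
      then show ?thesis
        using sec by (simp add: vimage_def)
    next
      case False
      then have "Pair x -` S = {}"
        using S by auto
      then show ?thesis
        using False by simp
    qed
  qed
  also have "\<dots> = ennreal (F b - F a)"
    by (intro nn_integral_FTC_Icc assms) auto
  finally show *: "emeasure lborel S = ennreal (F b - F a)"
    by (simp add: lborel_prod)
  \<comment> \<open>Monotonicity of \<open>F\<close> keeps \<open>ennreal\<close> from truncating
    \<open>F b - F a\<close> to zero.\<close>
  have "F a \<le> F b"
  proof (rule DERIV_nonneg_imp_nondecreasing[OF assms(3)])
    fix x assume "a \<le> x" "x \<le> b"
    then show "\<exists>y. (F has_real_derivative y) (at x) \<and> 0 \<le> y"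
      using F[of x] f[of x] by (intro exI[of _ "f x"] conjI)
  qed
  with * show "measure lborel S = F b - F a"
    by (simp add: measure_def)
qed

text \<open>The truncated power of spline theory. For \<open>n = 0\<close> it is constantly 1 and
  not a step function.\<close>

definition tpow :: "nat \<Rightarrow> real \<Rightarrow> real" where
  "tpow n x = max 0 x ^ n"

lemma tpow_nonneg [simp]: "0 \<le> tpow n x"
  by (simp add: tpow_def)

lemma continuous_on_tpow [continuous_intros]:
  "continuous_on S f \<Longrightarrow> continuous_on S (\<lambda>x. tpow n (f x))"
  unfolding tpow_def by (intro continuous_intros)

lemma borel_measurable_tpow [measurable]: "tpow n \<in> borel_measurable borel"
  by (intro borel_measurable_continuous_onI continuous_intros)

lemma tpow_mono: "x \<le> y \<Longrightarrow> tpow n x \<le> tpow n y"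
  unfolding tpow_def by (intro power_mono) auto

text \<open>The exponent is at least two, so at 0 Caratheodory's criterion applies with the
  continuous slope \<open>tpow (Suc n)\<close>, which vanishes there; elsewhere the function is
  locally zero or an ordinary power.\<close>

lemma has_real_derivative_tpow: "(tpow (Suc (Suc n)) has_real_derivative real (n + 2) * tpow (Suc n) x) (at x)"
proof -
  consider "x < 0" | "x = 0" | "x > 0" by linarith
  then show ?thesis
  proof cases
    case 1
    have "((\<lambda>_. 0) has_real_derivative 0) (at x)"
      by simp
    moreover have "eventually (\<lambda>y. 0 = tpow (Suc (Suc n)) y) (nhds x)"
      using eventually_nhds_in_open[OF open_lessThan, of x 0] 1
      by (auto elim!: eventually_mono simp: tpow_def)
    ultimately show ?thesis
      using 1 DERIV_cong_ev[of x x "\<lambda>_. 0" "tpow (Suc (Suc n))" 0 0] by (simp add: tpow_def)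
  next
    case 2
    have "tpow (Suc (Suc n)) z - tpow (Suc (Suc n)) 0 = tpow (Suc n) z * (z - 0)" for z
      by (simp add: tpow_def max_def)
    moreover have "isCont (tpow (Suc n)) 0"
      using continuous_on_tpow[OF continuous_on_id, of UNIV] by (simp add: continuous_on_eq_continuous_at)
    ultimately show ?thesis
      unfolding 2 CARAT_DERIV by (intro exI[of _ "tpow (Suc n)"]) (simp add: tpow_def)
  next
    case 3
    have "((\<lambda>y. y ^ Suc (Suc n)) has_real_derivative real (n + 2) * x ^ Suc n) (at x)"
      using DERIV_pow[of "Suc (Suc n)" x UNIV] by simp
    moreover have "eventually (\<lambda>y. y ^ Suc (Suc n) = tpow (Suc (Suc n)) y) (nhds x)"
      using eventually_nhds_in_open[OF open_greaterThan, of x 0] 3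
      by (auto elim!: eventually_mono simp: tpow_def max_def)
    ultimately show ?thesis
      using 3 DERIV_cong_ev[of x x "\<lambda>y. y ^ Suc (Suc n)" "tpow (Suc (Suc n))" "real (n + 2) * x ^ Suc n" "real (n + 2) * x ^ Suc n"]
      by (simp add: tpow_def)
  qed
qed

lemma DERIV_tpow2 [derivative_intros]:
  assumes "(g has_real_derivative g') (at x within S)"
  shows "((\<lambda>x. tpow 2 (g x)) has_real_derivative 2 * tpow 1 (g x) * g') (at x within S)"
proof (rule DERIV_chain2[OF _ assms])
  show "(tpow 2 has_real_derivative 2 * tpow 1 (g x)) (at (g x))"
    using has_real_derivative_tpow[of 0 "g x"] by (simp add: numeral_2_eq_2)
qed

lemma DERIV_tpow3 [derivative_intros]:
  assumes "(g has_real_derivative g') (at x within S)"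
  shows "((\<lambda>x. tpow 3 (g x)) has_real_derivative 3 * tpow 2 (g x) * g') (at x within S)"
proof (rule DERIV_chain2[OF _ assms])
  show "(tpow 3 has_real_derivative 3 * tpow 2 (g x)) (at (g x))"
    using has_real_derivative_tpow[of 1 "g x"] by (simp add: eval_nat_numeral)
qed

text \<open>Inclusion and exclusion of the corners \<open>y > A\<close> and \<open>z > B\<close> of a right triangle.\<close>

lemma emeasure_truncated_triangle:
  assumes "0 \<le> A" "0 \<le> B"
  shows "emeasure lborel {(y, z). 0 \<le> y \<and> y \<le> A \<and> 0 \<le> z \<and> z \<le> B \<and> y + z \<le> C} =
    ennreal ((tpow 2 C - tpow 2 (C - A) - tpow 2 (C - B) + tpow 2 (C - A - B)) / 2)" (is ?em)
    and "0 \<le> tpow 2 C - tpow 2 (C - A) - tpow 2 (C - B) + tpow 2 (C - A - B)" (is ?nonneg)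
proof -
  define F where "F y = (tpow 2 (C - B - y) - tpow 2 (C - y)) / 2" for y
  have "emeasure lborel {(y, z). 0 \<le> y \<and> y \<le> A \<and> 0 \<le> z \<and> z \<le> B \<and> y + z \<le> C} = ennreal (F A - F 0)"
  proof (rule emeasure_Icc_sections(1)[where f = "\<lambda>y. tpow 1 (C - y) - tpow 1 (C - B - y)" and F = F and a = 0 and b = A])
    show "closed {(y, z). 0 \<le> y \<and> y \<le> A \<and> 0 \<le> z \<and> z \<le> B \<and> y + z \<le> C}"
      unfolding case_prod_beta by (intro closed_Collect_conj closed_Collect_le continuous_intros)
    show "(F has_real_derivative tpow 1 (C - x) - tpow 1 (C - B - x)) (at x)" for x
      unfolding F_def by (auto intro!: derivative_eq_intros simp: field_simps)
    show "0 \<le> tpow 1 (C - x) - tpow 1 (C - B - x)" for x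
      using assms by (simp add: tpow_mono)
    fix x assume x: "0 \<le> x" "x \<le> A"
    then have "{z. (x, z) \<in> {(y, z). 0 \<le> y \<and> y \<le> A \<and> 0 \<le> z \<and> z \<le> B \<and> y + z \<le> C}} = {0 .. min B (C - x)}"
      by auto
    \<comment> \<open>For \<open>C < x\<close> the interval is empty, and both truncated terms
      vanish because \<open>0 \<le> B\<close>.\<close>
    moreover have "emeasure lborel {0 .. min B (C - x)} = ennreal (tpow 1 (C - x) - tpow 1 (C - B - x))"
      using assms by (auto simp: tpow_def emeasure_lborel_Icc_eq min_def max_def)
    ultimately show "emeasure lborel {z. (x, z) \<in> {(y, z). 0 \<le> y \<and> y \<le> A \<and> 0 \<le> z \<and> z \<le> B \<and> y + z \<le> C}} =
        ennreal (tpow 1 (C - x) - tpow 1 (C - B - x))"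
      by simp
  qed (use assms in auto)
  also have eq: "F A - F 0 = (tpow 2 C - tpow 2 (C - A) - tpow 2 (C - B) + tpow 2 (C - A - B)) / 2"
    by (simp add: F_def field_simps)
  finally show ?em .
  have "F 0 \<le> F A"
  proof (rule DERIV_nonneg_imp_nondecreasing[OF assms(1)])
    fix x
    have "(F has_real_derivative tpow 1 (C - x) - tpow 1 (C - B - x)) (at x)"
      unfolding F_def by (auto intro!: derivative_eq_intros simp: field_simps)
    moreover have "0 \<le> tpow 1 (C - x) - tpow 1 (C - B - x)"
      using assms by (simp add: tpow_mono)
    ultimately show "\<exists>y. (F has_real_derivative y) (at x) \<and> 0 \<le> y"
      by blast
  qed
  with eq show ?nonneg
    by simp
qed

section \<open>Volumes of the fibre polytopes, one for each knot pattern\<close>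

lemma measure_simplex3:
  "measure lborel {(x, y, z). 0 \<le> x \<and> 0 \<le> y \<and> 0 \<le> z \<and> x + y + z \<le> c} = tpow 3 c / 6"
proof -
  \<comment> \<open>For negative \<open>c\<close> the polytope is empty; the maximum keeps the range
    of integration nonempty.\<close>
  let ?c = "max 0 c"
  define F where "F x = - tpow 3 (c - x) / 6" for x
  have "measure lborel {(x, y, z). 0 \<le> x \<and> 0 \<le> y \<and> 0 \<le> z \<and> x + y + z \<le> c} = F ?c - F 0"
  proof (rule emeasure_Icc_sections(2)[where f = "\<lambda>x. tpow 2 (c - x) / 2" and F = F and a = 0 and b = ?c])
    show "closed {(x, y, z). 0 \<le> x \<and> 0 \<le> y \<and> 0 \<le> z \<and> x + y + z \<le> c}"
      unfolding case_prod_beta by (intro closed_Collect_conj closed_Collect_le continuous_intros)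
    show "(F has_real_derivative tpow 2 (c - x) / 2) (at x)" for x
      unfolding F_def by (auto intro!: derivative_eq_intros simp: field_simps)
    fix x assume x: "0 \<le> x" "x \<le> ?c"
    \<comment> \<open>The added upper bounds follow from the other inequalities. They give the
      section the shape of a truncated triangle, for which inclusion and exclusion has at most one
      nonzero term here.\<close>
    have "{p. (x, p) \<in> {(x, y, z). 0 \<le> x \<and> 0 \<le> y \<and> 0 \<le> z \<and> x + y + z \<le> c}} =
        {(y, z). 0 \<le> y \<and> y \<le> max 0 (c - x) \<and> 0 \<le> z \<and> z \<le> max 0 (c - x) \<and> y + z \<le> c - x}"
      using x by auto
    then show "emeasure lborel {p. (x, p) \<in> {(x, y, z). 0 \<le> x \<and> 0 \<le> y \<and> 0 \<le> z \<and> x + y + z \<le> c}} =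
        ennreal (tpow 2 (c - x) / 2)"
      by (simp add: emeasure_truncated_triangle(1)) (simp add: tpow_def max_def)
  qed auto
  also have "F ?c - F 0 = tpow 3 c / 6"
    by (simp add: F_def tpow_def)
  finally show ?thesis .
qed

text \<open>The simplex \<open>x / 2 + y + z \<le> c\<close> has volume \<open>tpow 3 c / 3\<close>,
  and the bound \<open>x / 2 \<le> s\<close> cuts off a similar simplex of size
  \<open>c - s\<close>.\<close>

lemma measure_polytope_edge:
  assumes "0 \<le> s"
  shows "measure lborel {(x, y, z). 0 \<le> x \<and> 0 \<le> y \<and> 0 \<le> z \<and> x / 2 \<le> s \<and> x / 2 + y + z \<le> c} =
    (tpow 3 c - tpow 3 (c - s)) / 3"
proof -
  define F where "F x = - tpow 3 (c - x / 2) / 3" for x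
  have "measure lborel {(x, y, z). 0 \<le> x \<and> 0 \<le> y \<and> 0 \<le> z \<and> x / 2 \<le> s \<and> x / 2 + y + z \<le> c} = F (2 * s) - F 0"
  proof (rule emeasure_Icc_sections(2)[where f = "\<lambda>x. tpow 2 (c - x / 2) / 2" and F = F and a = 0 and b = "2 * s"])
    show "closed {(x, y, z). 0 \<le> x \<and> 0 \<le> y \<and> 0 \<le> z \<and> x / 2 \<le> s \<and> x / 2 + y + z \<le> c}"
      unfolding case_prod_beta by (intro closed_Collect_conj closed_Collect_le continuous_intros) auto
    show "(F has_real_derivative tpow 2 (c - x / 2) / 2) (at x)" for x
      unfolding F_def by (auto intro!: derivative_eq_intros simp: field_simps)
    fix x assume x: "0 \<le> x" "x \<le> 2 * s"
    have "{p. (x, p) \<in> {(x, y, z). 0 \<le> x \<and> 0 \<le> y \<and> 0 \<le> z \<and> x / 2 \<le> s \<and> x / 2 + y + z \<le> c}} =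
        {(y, z). 0 \<le> y \<and> y \<le> max 0 (c - x / 2) \<and> 0 \<le> z \<and> z \<le> max 0 (c - x / 2) \<and> y + z \<le> c - x / 2}"
      using x by auto
    then show "emeasure lborel {p. (x, p) \<in> {(x, y, z). 0 \<le> x \<and> 0 \<le> y \<and> 0 \<le> z \<and> x / 2 \<le> s \<and> x / 2 + y + z \<le> c}} =
        ennreal (tpow 2 (c - x / 2) / 2)"
      by (simp add: emeasure_truncated_triangle(1)) (simp add: tpow_def max_def)
  qed (use assms in auto)
  also have "F (2 * s) - F 0 = (tpow 3 c - tpow 3 (c - s)) / 3"
    by (simp add: F_def)
  finally show ?thesis .
qed

text \<open>For fixed \<open>x\<close> the other two variables range over a rectangle, whose shorter
  side shrinks to zero at \<open>x = 2 * m\<close>. This is the origin of the minimum.\<close>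

lemma measure_polytope_double_edge:
  assumes "0 \<le> s" "0 \<le> t"
  defines "m \<equiv> min s t"
  shows "measure lborel {(x, y, z). 0 \<le> x \<and> 0 \<le> y \<and> 0 \<le> z \<and> x / 2 + z \<le> t \<and> x / 2 + y \<le> s} =
    2 * s * t * m - (s + t) * m\<^sup>2 + 2 * m ^ 3 / 3"
proof -
  let ?S = "{(x, y, z). 0 \<le> x \<and> 0 \<le> y \<and> 0 \<le> z \<and> x / 2 + z \<le> t \<and> x / 2 + y \<le> s}"
  have m: "0 \<le> m" "m \<le> s" "m \<le> t"
    using assms by auto
  define F where "F x = s * t * x - (s + t) * x\<^sup>2 / 4 + x ^ 3 / 12" for x
  have "measure lborel ?S = F (2 * m) - F 0"
  proof (rule emeasure_Icc_sections(2)[where f = "\<lambda>x. (s - x / 2) * (t - x / 2)" and F = F and a = 0 and b = "2 * m"])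
    show "closed ?S"
      unfolding case_prod_beta by (intro closed_Collect_conj closed_Collect_le continuous_intros) auto
    show "(F has_real_derivative (s - x / 2) * (t - x / 2)) (at x)" for x
      unfolding F_def by (auto intro!: derivative_eq_intros simp: field_simps power2_eq_square)
    fix x assume x: "0 \<le> x" "x \<le> 2 * m"
    then show "0 \<le> (s - x / 2) * (t - x / 2)"
      using m by simp
    have "{p. (x, p) \<in> ?S} = {0 .. s - x / 2} \<times> {0 .. t - x / 2}"
      using x by auto
    moreover have "emeasure lborel ({0 .. s - x / 2} \<times> {0 .. t - x / 2}) = ennreal ((s - x / 2) * (t - x / 2))"
    proof -
      have "emeasure (lborel \<Otimes>\<^sub>M lborel) ({0 .. s - x / 2} \<times> {0 .. t - x / 2}) = ennreal (s - x / 2) * ennreal (t - x / 2)"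
        using x m by (subst lborel.emeasure_pair_measure_Times) auto
      then show ?thesis
        using x m by (simp add: lborel_prod ennreal_mult)
    qed
    ultimately show "emeasure lborel {p. (x, p) \<in> ?S} = ennreal ((s - x / 2) * (t - x / 2))"
      by simp
  qed (use m in \<open>auto simp: m_def\<close>)
  also have "F (2 * m) - F 0 = 2 * s * t * m - (s + t) * m\<^sup>2 + 2 * m ^ 3 / 3"
    by (simp add: F_def field_simps power2_eq_square power3_eq_cube)
  finally show ?thesis .
qed

text \<open>Inclusion and exclusion for a simplex of volume \<open>2 / 3 * tpow 3 c\<close>, from
  which the bounds on \<open>x\<close> and \<open>y\<close> cut off two corners that may overlap;
  the overlap has size \<open>c - s - t\<close>.\<close>

lemma measure_polytope_inner:
  assumes "0 \<le> s" "0 \<le> t"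
  shows "measure lborel {(x, y, z). 0 \<le> x \<and> 0 \<le> y \<and> 0 \<le> z \<and> x / 2 \<le> s \<and> y / 2 \<le> t \<and> x / 2 + y / 2 + z \<le> c} =
    2 / 3 * (tpow 3 c - tpow 3 (c - s) - tpow 3 (c - t) + tpow 3 (c - s - t))"
proof -
  let ?S = "{(x, y, z). 0 \<le> x \<and> 0 \<le> y \<and> 0 \<le> z \<and> x / 2 \<le> s \<and> y / 2 \<le> t \<and> x / 2 + y / 2 + z \<le> c}"
  define F where "F x = 2 / 3 * (tpow 3 (c - t - x / 2) - tpow 3 (c - x / 2))" for x
  have "measure lborel ?S = F (2 * s) - F 0"
  proof (rule emeasure_Icc_sections(2)[where f = "\<lambda>x. tpow 2 (c - x / 2) - tpow 2 (c - t - x / 2)" and F = F and a = 0 and b = "2 * s"])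
    show "closed ?S"
      unfolding case_prod_beta by (intro closed_Collect_conj closed_Collect_le continuous_intros) auto
    show "(F has_real_derivative tpow 2 (c - x / 2) - tpow 2 (c - t - x / 2)) (at x)" for x
      unfolding F_def by (auto intro!: derivative_eq_intros simp: field_simps)
    show "0 \<le> tpow 2 (c - x / 2) - tpow 2 (c - t - x / 2)" for x
      using assms by (simp add: tpow_mono)
    fix x assume x: "0 \<le> x" "x \<le> 2 * s"
    define G where "G y = - tpow 2 (c - x / 2 - y / 2)" for y
    let ?T = "{(y, z). 0 \<le> y \<and> 0 \<le> z \<and> y / 2 \<le> t \<and> x / 2 + y / 2 + z \<le> c}"
    have "{p. (x, p) \<in> ?S} = ?T"
      using x by auto
    moreover have "emeasure lborel ?T = ennreal (G (2 * t) - G 0)"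
    proof (rule emeasure_Icc_sections(1)[where f = "\<lambda>y. tpow 1 (c - x / 2 - y / 2)" and F = G and a = 0 and b = "2 * t"])
      show "closed ?T"
        unfolding case_prod_beta by (intro closed_Collect_conj closed_Collect_le continuous_intros) auto
      show "(G has_real_derivative tpow 1 (c - x / 2 - y / 2)) (at y)" for y
        unfolding G_def by (auto intro!: derivative_eq_intros simp: field_simps)
      fix y assume y: "0 \<le> y" "y \<le> 2 * t"
      then have "{z. (y, z) \<in> ?T} = {0 .. c - x / 2 - y / 2}"
        by auto
      then show "emeasure lborel {z. (y, z) \<in> ?T} = ennreal (tpow 1 (c - x / 2 - y / 2))"
        by (auto simp: tpow_def emeasure_lborel_Icc_eq max_def)
    qed (use assms in auto)
    ultimately show "emeasure lborel {p. (x, p) \<in> ?S} = ennreal (tpow 2 (c - x / 2) - tpow 2 (c - t - x / 2))"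
      by (simp add: G_def algebra_simps)
  qed (use assms in auto)
  also have "F (2 * s) - F 0 = 2 / 3 * (tpow 3 c - tpow 3 (c - s) - tpow 3 (c - t) + tpow 3 (c - s - t))"
    by (simp add: F_def algebra_simps)
  finally show ?thesis .
qed

text \<open>The sections have \<open>x \<le> 2 * min b w\<close>; the truncated cube of \<open>w - b\<close> is what makes one formula
  cover both cases of the minimum.\<close>

lemma measure_polytope_central:
  assumes "0 \<le> a" "0 \<le> b" "0 \<le> w" and sum: "a + b + w = 1"
  shows "measure lborel {(x, y, z). 0 \<le> x \<and> 0 \<le> y \<and> 0 \<le> z \<and> x / 2 + y / 2 \<le> b \<and> x / 2 + z / 2 \<le> w \<and> y / 2 + z / 2 \<le> a} =
    2 / 3 * (6 * a\<^sup>2 * w - 2 * a ^ 3 - (1 - 2 * b) ^ 3 + 2 * tpow 3 (a - w) + 2 * tpow 3 (a - b) + 2 * tpow 3 (w - b)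
      - tpow 3 (2 * a - 1) - tpow 3 (2 * b - 1) - tpow 3 (2 * w - 1))"
proof -
  let ?S = "{(x, y, z). 0 \<le> x \<and> 0 \<le> y \<and> 0 \<le> z \<and> x / 2 + y / 2 \<le> b \<and> x / 2 + z / 2 \<le> w \<and> y / 2 + z / 2 \<le> a}"
  define m where "m = min b w"
  have m: "0 \<le> m" "m \<le> b" "m \<le> w"
    using assms by (auto simp: m_def)
  define f where "f x = (tpow 2 (2 * a) - tpow 2 (2 * a - (2 * b - x)) - tpow 2 (2 * a - (2 * w - x))
      + tpow 2 (2 * a - (2 * b - x) - (2 * w - x))) / 2" for x
  define F where "F x = (tpow 2 (2 * a) * x - tpow 3 (2 * a - (2 * b - x)) / 3 - tpow 3 (2 * a - (2 * w - x)) / 3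
      + tpow 3 (2 * a - (2 * b - x) - (2 * w - x)) / 6) / 2" for x
  have "measure lborel ?S = F (2 * m) - F 0"
  proof (rule emeasure_Icc_sections(2)[where f = f and F = F and a = 0 and b = "2 * m"])
    show "closed ?S"
      unfolding case_prod_beta by (intro closed_Collect_conj closed_Collect_le continuous_intros) auto
    show "(F has_real_derivative f x) (at x)" for x
      unfolding F_def f_def by (auto intro!: derivative_eq_intros simp: field_simps)
    show "f \<in> borel_measurable borel"
      unfolding f_def[abs_def] by measurable
    fix x assume x: "0 \<le> x" "x \<le> 2 * m"
    have "{p. (x, p) \<in> ?S} = {(y, z). 0 \<le> y \<and> y \<le> 2 * b - x \<and> 0 \<le> z \<and> z \<le> 2 * w - x \<and> y + z \<le> 2 * a}"
      using x by auto
    then show "emeasure lborel {p. (x, p) \<in> ?S} = ennreal (f x)"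
      using emeasure_truncated_triangle(1)[of "2 * b - x" "2 * w - x" "2 * a"] x m by (simp add: f_def)
    show "0 \<le> f x"
      using emeasure_truncated_triangle(2)[of "2 * b - x" "2 * w - x" "2 * a"] x m by (simp add: f_def)
  qed (use m in \<open>auto simp: m_def\<close>)
  also have "F (2 * m) - F 0 = 2 / 3 * (6 * a\<^sup>2 * w - 2 * a ^ 3 - (1 - 2 * b) ^ 3 + 2 * tpow 3 (a - w) + 2 * tpow 3 (a - b) + 2 * tpow 3 (w - b)
      - tpow 3 (2 * a - 1) - tpow 3 (2 * b - 1) - tpow 3 (2 * w - 1))"
  proof -
    have scale: "tpow 3 (2 * x) = 8 * tpow 3 x" for x
      by (simp add: tpow_def max_def)
    \<comment> \<open>A cube is the difference of the truncated cubes of its base and of the negated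
      base, so a truncated cube can be traded for a polynomial and its mirror image.\<close>
    have refl: "tpow 3 (1 - 2 * x) = (1 - 2 * x) ^ 3 + tpow 3 (2 * x - 1)" for x
      by (simp add: tpow_def max_def power3_eq_cube algebra_simps)
    have a2: "tpow 2 (2 * a) = 4 * a\<^sup>2" and a3: "tpow 3 a = a ^ 3"
      using assms by (simp_all add: tpow_def max_def)
    have F0: "F 0 = 4 * (- tpow 3 (a - b) / 3 - tpow 3 (a - w) / 3 + tpow 3 (2 * a - 1) / 6)"
    proof -
      have *: "2 * a - (2 * b - 0) = 2 * (a - b)" "2 * a - (2 * w - 0) = 2 * (a - w)"
        "2 * (a - b) - (2 * w - 0) = 2 * (2 * a - 1)"
        using sum by simp_all
      show ?thesis
        unfolding F_def * scale by simp
    qed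
    show ?thesis
    proof (cases "b \<le> w")
      case True
      then have "m = b"
        by (simp add: m_def)
      have *: "2 * a - (2 * b - 2 * b) = 2 * a" "2 * a - (2 * w - 2 * b) = 2 * (1 - 2 * w)"
        using sum by simp_all
      have Fm: "F (2 * m) = 4 * (a\<^sup>2 * b - a ^ 3 / 3 - tpow 3 (1 - 2 * w) / 6)"
        unfolding F_def \<open>m = b\<close> * a2 scale a3 by (simp add: field_simps)
      have t: "tpow 3 (2 * b - 1) = 0" "tpow 3 (w - b) = (w - b) ^ 3"
        using True sum assms by (simp_all add: tpow_def max_def)
      have a: "a = 1 - b - w"
        using sum by simp
      \<comment> \<open>On \<open>a + b + w = 1\<close>, exchanging \<open>b\<close> and
        \<open>w\<close> in this polynomial part changes it by \<open>2 * (w - b) ^ 3\<close>, which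
        fixes the coefficient 2 of the truncated cube of \<open>w - b\<close>.\<close>
      have "6 * a\<^sup>2 * b - (1 - 2 * w) ^ 3 = 6 * a\<^sup>2 * w - (1 - 2 * b) ^ 3 + 2 * (w - b) ^ 3"
        unfolding a by (simp add: algebra_simps power2_eq_square power3_eq_cube)
      then show ?thesis
        unfolding F0 Fm t refl by (simp add: field_simps)
    next
      case False
      then have "m = w"
        by (simp add: m_def)
      have *: "2 * a - (2 * w - 2 * w) = 2 * a" "2 * a - (2 * b - 2 * w) = 2 * (1 - 2 * b)"
        "2 * (1 - 2 * b) - (2 * w - 2 * w) = 2 * (1 - 2 * b)"
        using sum by simp_all
      have "F (2 * m) = 4 * (a\<^sup>2 * w - a ^ 3 / 3 - tpow 3 (1 - 2 * b) / 6)"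
        unfolding F_def \<open>m = w\<close> * a2 scale a3 by (simp add: field_simps)
      moreover have "tpow 3 (2 * w - 1) = 0" "tpow 3 (w - b) = 0"
        using False sum assms by (simp_all add: tpow_def max_def)
      ultimately show ?thesis
        unfolding F0 refl by (simp add: field_simps)
    qed
  qed
  finally show ?thesis .
qed

section \<open>The basis in barycentric coordinates\<close>

lemma pt_knots:
  "pt q0 q1 q2 0 0 = q0" "pt q0 q1 q2 1 0 = q1"
  "pt q0 q1 q2 (1/2) 0 = midpoint q0 q1" "pt q0 q1 q2 0 (1/2) = midpoint q0 q2"
  "pt q0 q1 q2 (1/2) (1/2) = midpoint q1 q2"
  by (simp_all add: pt_def midpoint_def vec_eq_iff field_simps)

definition bary :: "plane \<Rightarrow> plane \<Rightarrow> plane \<Rightarrow> real \<Rightarrow> real \<Rightarrow> real \<Rightarrow> plane" where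
  "bary q1 q2 q3 a b w = a *\<^sub>R q1 + b *\<^sub>R q2 + w *\<^sub>R q3"

text \<open>The vertices are parameters so that each knot pattern is treated once and then used
  under all relabellings. The set \<Delta> stays abstract: only its area enters, and that does not
  depend on the order of the vertices.\<close>

locale spline_triangle =
  fixes \<Delta> :: "plane set" and q1 q2 q3 :: plane and a b w :: real
  assumes jac_nz: "jac q1 q2 q3 \<noteq> 0"
    and area: "measure lborel \<Delta> = \<bar>jac q1 q2 q3\<bar> / 2"
    and nonneg: "0 \<le> a" "0 \<le> b" "0 \<le> w" and sum1: "a + b + w = 1"
begin

lemma a_eq: "a = 1 - b - w"
  using sum1 by simp

text \<open>All knots lie in the corner triangle at \<open>q1\<close>, which has a quarter of the
  area and barycentric coordinates \<open>2 * a - 1\<close>, \<open>2 * b\<close>,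
  \<open>2 * w\<close>. Outside it \<open>2 * a - 1\<close> is negative and the truncation gives
  zero.\<close>

lemma spline_corner:
  assumes "mset ks = {#q1, q1, q1, q1, midpoint q1 q2, midpoint q1 q3#}"
  shows "simplex_spline \<Delta> ks (bary q1 q2 q3 a b w) = 4 * tpow 3 (2 * a - 1)"
proof -
  let ?m2 = "midpoint q1 q2" and ?m3 = "midpoint q1 q3"
  have ks: "mset ks = {#q1, ?m2, ?m3, pt q1 ?m2 ?m3 0 0, pt q1 ?m2 ?m3 0 0, pt q1 ?m2 ?m3 0 0#}"
    using assms by (simp add: pt_knots add_mset_commute)
  have jac: "jac q1 ?m2 ?m3 = jac q1 q2 q3 / 4"
    by (simp add: jac_def midpoint_def field_simps)
  have x: "bary q1 q2 q3 a b w = pt q1 ?m2 ?m3 (2 * b) (2 * w)"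
    by (simp add: bary_def pt_def a_eq vec_eq_iff midpoint_def field_simps)
  show ?thesis
    unfolding x using simplex_spline_pt[OF ks, of \<Delta> "2 * b" "2 * w"] jac_nz nonneg measure_simplex3[of "2 * a - 1"]
    by (simp add: jac area a_eq algebra_simps)
qed

text \<open>The knots span the half triangle \<open>q1, q2, midpoint q1 q3\<close>, in which the
  barycentric coordinates are \<open>a - w\<close>, \<open>b\<close> and
  \<open>2 * w\<close>.\<close>

lemma spline_edge:
  assumes "mset ks = {#q1, q1, q1, q2, midpoint q1 q2, midpoint q1 q3#}"
  shows "simplex_spline \<Delta> ks (bary q1 q2 q3 a b w) = 4 * (tpow 3 (a - w) - tpow 3 (2 * a - 1))"
proof -
  let ?m3 = "midpoint q1 q3"
  have ks: "mset ks = {#q1, q2, ?m3, pt q1 q2 ?m3 (1/2) 0, pt q1 q2 ?m3 0 0, pt q1 q2 ?m3 0 0#}"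
    using assms by (simp add: pt_knots midpoint_sym add_mset_commute)
  have jac: "jac q1 q2 ?m3 = jac q1 q2 q3 / 2"
    by (simp add: jac_def midpoint_def field_simps)
  have x: "bary q1 q2 q3 a b w = pt q1 q2 ?m3 b (2 * w)"
    by (simp add: bary_def pt_def a_eq vec_eq_iff midpoint_def field_simps)
  have eqs: "1 - b - 2 * w = a - w" "a - w - b = 2 * a - 1"
    using sum1 by simp_all
  show ?thesis
    unfolding x using simplex_spline_pt[OF ks, of \<Delta> b "2 * w"] jac_nz nonneg measure_polytope_edge[of b "a - w"]
    by (simp add: jac area eqs)
qed

lemma spline_double_edge:
  assumes "mset ks = {#q1, q1, q2, q2, q3, midpoint q1 q2#}"
  shows "simplex_spline \<Delta> ks (bary q1 q2 q3 a b w) = 6 * a * b\<^sup>2 - 2 * b ^ 3 + 2 * tpow 3 (b - a)"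
proof -
  have ks: "mset ks = {#q1, q2, q3, pt q1 q2 q3 (1/2) 0, pt q1 q2 q3 0 0, pt q1 q2 q3 1 0#}"
    using assms by (simp add: pt_knots midpoint_sym add_mset_commute)
  have x: "bary q1 q2 q3 a b w = pt q1 q2 q3 b w"
    by (simp add: bary_def pt_def a_eq vec_eq_iff field_simps)
  have eqs: "1 - b - w = a"
    using sum1 by simp_all
  have "simplex_spline \<Delta> ks (bary q1 q2 q3 a b w) = 6 * (2 * a * b * min a b - (a + b) * (min a b)\<^sup>2 + 2 * (min a b) ^ 3 / 3)"
    unfolding x using simplex_spline_pt[OF ks, of \<Delta> b w] jac_nz nonneg measure_polytope_double_edge[of a b]
    by (simp add: area eqs)
  \<comment> \<open>A minimum hides the smoothness across \<open>a = b\<close>; the truncated cube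
    displays it.\<close>
  also have "\<dots> = 6 * a * b\<^sup>2 - 2 * b ^ 3 + 2 * tpow 3 (b - a)"
    by (simp add: min_def tpow_def max_def field_simps power2_eq_square power3_eq_cube)
  finally show ?thesis .
qed

lemma spline_inner:
  assumes "mset ks = {#q1, q1, q2, q3, midpoint q1 q2, midpoint q1 q3#}"
  shows "simplex_spline \<Delta> ks (bary q1 q2 q3 a b w) =
    4 * (a ^ 3 - tpow 3 (a - b) - tpow 3 (a - w) + tpow 3 (2 * a - 1))"
proof -
  have ks: "mset ks = {#q1, q2, q3, pt q1 q2 q3 (1/2) 0, pt q1 q2 q3 0 (1/2), pt q1 q2 q3 0 0#}"
    using assms by (simp add: pt_knots midpoint_sym add_mset_commute)
  have x: "bary q1 q2 q3 a b w = pt q1 q2 q3 b w"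
    by (simp add: bary_def pt_def a_eq vec_eq_iff field_simps)
  have eqs: "1 - b - w = a" "a - b - w = 2 * a - 1" "tpow 3 a = a ^ 3"
    using sum1 nonneg by (simp_all add: tpow_def)
  show ?thesis
    unfolding x using simplex_spline_pt[OF ks, of \<Delta> b w] jac_nz nonneg measure_polytope_inner[of b w a]
    by (simp add: area eqs)
qed

lemma spline_central:
  assumes "mset ks = {#q1, q2, q3, midpoint q1 q2, midpoint q2 q3, midpoint q3 q1#}"
  shows "simplex_spline \<Delta> ks (bary q1 q2 q3 a b w) =
    4 * (6 * a\<^sup>2 * w - 2 * a ^ 3 - (1 - 2 * b) ^ 3 + 2 * tpow 3 (a - w) + 2 * tpow 3 (a - b) + 2 * tpow 3 (w - b)
      - tpow 3 (2 * a - 1) - tpow 3 (2 * b - 1) - tpow 3 (2 * w - 1))"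
proof -
  have ks: "mset ks = {#q1, q2, q3, pt q1 q2 q3 (1/2) (1/2), pt q1 q2 q3 (1/2) 0, pt q1 q2 q3 0 (1/2)#}"
    using assms by (simp add: pt_knots midpoint_sym add_mset_commute)
  have x: "bary q1 q2 q3 a b w = pt q1 q2 q3 b w"
    by (simp add: bary_def pt_def a_eq vec_eq_iff field_simps)
  have eqs: "1 - b - w = a"
    using sum1 nonneg by (simp_all add: tpow_def)
  show ?thesis
    unfolding x using simplex_spline_pt[OF ks, of \<Delta> b w] jac_nz measure_polytope_central[OF nonneg sum1]
    by (simp add: area eqs)
qed

end

section \<open>Closed forms of the normalised basis functions\<close>

definition corner_fn :: "real \<Rightarrow> real" where
  "corner_fn a = tpow 3 (2 * a - 1)"

definition edge_fn :: "real \<Rightarrow> real \<Rightarrow> real" where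
  "edge_fn a w = 2 * (tpow 3 (a - w) - tpow 3 (2 * a - 1))"

definition double_edge_fn :: "real \<Rightarrow> real \<Rightarrow> real" where
  "double_edge_fn a b = 6 * a * b\<^sup>2 - 2 * b ^ 3 + 2 * tpow 3 (b - a)"

definition inner_fn :: "real \<Rightarrow> real \<Rightarrow> real \<Rightarrow> real" where
  "inner_fn a b w = 4 * (a ^ 3 - tpow 3 (a - b) - tpow 3 (a - w) + tpow 3 (2 * a - 1))"

definition central_fn :: "real \<Rightarrow> real \<Rightarrow> real \<Rightarrow> real" where
  "central_fn a b w = 6 * a\<^sup>2 * w - 2 * a ^ 3 - (1 - 2 * b) ^ 3
    + 2 * tpow 3 (a - w) + 2 * tpow 3 (a - b) + 2 * tpow 3 (w - b)
    - tpow 3 (2 * a - 1) - tpow 3 (2 * b - 1) - tpow 3 (2 * w - 1)"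

text \<open>The function \<^const>\<open>double_edge_fn\<close> is symmetric. Where \<open>w\<close> occurs it is made the
  second argument, because then the truncated cube has zero 2-jet on the edge \<open>w = 0\<close>.\<close>

definition S3_bary :: "real \<Rightarrow> real \<Rightarrow> real \<Rightarrow> real list" where
  "S3_bary a b w =
    [corner_fn a, edge_fn a w, double_edge_fn a b, edge_fn b w, corner_fn b,
     edge_fn b a, double_edge_fn b w, edge_fn w a, corner_fn w, edge_fn w b,
     double_edge_fn a w, edge_fn a b, inner_fn a b w, inner_fn b a w, inner_fn w a b, central_fn a b w]"

lemma S3_list_bary:
  assumes "jac p1 p2 p3 \<noteq> 0" "0 \<le> a" "0 \<le> b" "0 \<le> w" "a + b + w = 1"
  shows "S3_list p1 p2 p3 (bary p1 p2 p3 a b w) = S3_bary a b w"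
proof -
  let ?D = "convex hull {p1, p2, p3}" and ?x = "bary p1 p2 p3 a b w"
  have m: "measure lborel ?D = \<bar>jac p1 p2 p3\<bar> / 2"
    unfolding content_triangle jac_def by (simp add: algebra_simps abs_minus_commute)
  have j: "jac p2 p1 p3 = - jac p1 p2 p3" "jac p1 p3 p2 = - jac p1 p2 p3" "jac p2 p3 p1 = jac p1 p2 p3"
    "jac p3 p1 p2 = jac p1 p2 p3" "jac p3 p2 p1 = - jac p1 p2 p3"
    by (simp_all add: jac_def algebra_simps)
  \<comment> \<open>Each basis function is one of the five patterns after a permutation of the
    vertices, with the barycentric coordinates permuted alike; hence one interpretation for each of
    the six permutations.\<close>
  interpret T123: spline_triangle ?D p1 p2 p3 a b w
    using assms m j by unfold_locales auto
  interpret T213: spline_triangle ?D p2 p1 p3 b a w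
    using assms m j by unfold_locales auto
  interpret T132: spline_triangle ?D p1 p3 p2 a w b
    using assms m j by unfold_locales auto
  interpret T231: spline_triangle ?D p2 p3 p1 b w a
    using assms m j by unfold_locales auto
  interpret T312: spline_triangle ?D p3 p1 p2 w a b
    using assms m j by unfold_locales auto
  interpret T321: spline_triangle ?D p3 p2 p1 w b a
    using assms m j by unfold_locales auto
  have b213: "bary p2 p1 p3 b a w = ?x"
    by (simp add: bary_def ac_simps)
  have b132: "bary p1 p3 p2 a w b = ?x"
    by (simp add: bary_def ac_simps)
  have b231: "bary p2 p3 p1 b w a = ?x"
    by (simp add: bary_def ac_simps)
  have b312: "bary p3 p1 p2 w a b = ?x"
    by (simp add: bary_def ac_simps)
  have b321: "bary p3 p2 p1 w b a = ?x"
    by (simp add: bary_def ac_simps)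
  have Q1: "Q12 p1 p2 p3 4 0 0 1 0 1 ?x = 4 * corner_fn a"
    unfolding Q12_def corner_fn_def
    by (subst T123.spline_corner) (simp_all add: numeral_eq_Suc midpoint_sym add_mset_commute)
  have Q2: "Q12 p1 p2 p3 3 1 0 1 0 1 ?x = 2 * edge_fn a w"
    unfolding Q12_def edge_fn_def
    by (subst T123.spline_edge) (simp_all add: numeral_eq_Suc midpoint_sym add_mset_commute)
  have Q3: "Q12 p1 p2 p3 2 2 1 1 0 0 ?x = double_edge_fn a b"
    unfolding Q12_def double_edge_fn_def
    by (subst T123.spline_double_edge) (simp_all add: numeral_eq_Suc midpoint_sym add_mset_commute)
  have Q4: "Q12 p1 p2 p3 1 3 0 1 1 0 ?x = 2 * edge_fn b w"
    unfolding Q12_def edge_fn_def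
    by (subst T213.spline_edge[unfolded b213]) (simp_all add: numeral_eq_Suc midpoint_sym add_mset_commute)
  have Q5: "Q12 p1 p2 p3 0 4 0 1 1 0 ?x = 4 * corner_fn b"
    unfolding Q12_def corner_fn_def
    by (subst T213.spline_corner[unfolded b213]) (simp_all add: numeral_eq_Suc midpoint_sym add_mset_commute)
  have Q6: "Q12 p1 p2 p3 0 3 1 1 1 0 ?x = 2 * edge_fn b a"
    unfolding Q12_def edge_fn_def
    by (subst T231.spline_edge[unfolded b231]) (simp_all add: numeral_eq_Suc midpoint_sym add_mset_commute)
  have Q7: "Q12 p1 p2 p3 1 2 2 0 1 0 ?x = double_edge_fn b w"
    unfolding Q12_def double_edge_fn_def
    by (subst T231.spline_double_edge[unfolded b231]) (simp_all add: numeral_eq_Suc midpoint_sym add_mset_commute)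
  have Q8: "Q12 p1 p2 p3 0 1 3 0 1 1 ?x = 2 * edge_fn w a"
    unfolding Q12_def edge_fn_def
    by (subst T321.spline_edge[unfolded b321]) (simp_all add: numeral_eq_Suc midpoint_sym add_mset_commute)
  have Q9: "Q12 p1 p2 p3 0 0 4 0 1 1 ?x = 4 * corner_fn w"
    unfolding Q12_def corner_fn_def
    by (subst T321.spline_corner[unfolded b321]) (simp_all add: numeral_eq_Suc midpoint_sym add_mset_commute)
  have Q10: "Q12 p1 p2 p3 1 0 3 0 1 1 ?x = 2 * edge_fn w b"
    unfolding Q12_def edge_fn_def
    by (subst T312.spline_edge[unfolded b312]) (simp_all add: numeral_eq_Suc midpoint_sym add_mset_commute)
  have Q11: "Q12 p1 p2 p3 2 1 2 0 0 1 ?x = double_edge_fn a w"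
    unfolding Q12_def double_edge_fn_def
    by (subst T132.spline_double_edge[unfolded b132]) (simp_all add: numeral_eq_Suc midpoint_sym add_mset_commute)
  have Q12: "Q12 p1 p2 p3 3 0 1 1 0 1 ?x = 2 * edge_fn a b"
    unfolding Q12_def edge_fn_def
    by (subst T132.spline_edge[unfolded b132]) (simp_all add: numeral_eq_Suc midpoint_sym add_mset_commute)
  have Q13: "Q12 p1 p2 p3 2 1 1 1 0 1 ?x = inner_fn a b w"
    unfolding Q12_def inner_fn_def
    by (subst T123.spline_inner) (simp_all add: numeral_eq_Suc midpoint_sym add_mset_commute)
  have Q14: "Q12 p1 p2 p3 1 2 1 1 1 0 ?x = inner_fn b a w"
    unfolding Q12_def inner_fn_def
    by (subst T213.spline_inner[unfolded b213]) (simp_all add: numeral_eq_Suc midpoint_sym add_mset_commute)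
  have Q15: "Q12 p1 p2 p3 1 1 2 0 1 1 ?x = inner_fn w a b"
    unfolding Q12_def inner_fn_def
    by (subst T312.spline_inner[unfolded b312]) (simp_all add: numeral_eq_Suc midpoint_sym add_mset_commute)
  have Q16: "Q12 p1 p2 p3 1 1 1 1 1 1 ?x = 4 * central_fn a b w"
    unfolding Q12_def central_fn_def
    by (subst T123.spline_central) (simp_all add: numeral_eq_Suc midpoint_sym add_mset_commute)
  show ?thesis
    unfolding S3_list_def Let_def S3_bary_def Q1 Q2 Q3 Q4 Q5 Q6 Q7 Q8 Q9 Q10 Q11 Q12 Q13 Q14 Q15 Q16 by simp
qed

section \<open>Derivatives from within a triangle\<close>

text \<open>Cramer's rule for the component of \<open>h\<close> along \<open>q2 - q1\<close> in the
  basis \<open>q2 - q1, q3 - q1\<close>; it is the increment of the barycentric coordinate of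
  \<open>q2\<close> along \<open>h\<close>. The companion \<open>coord3\<close> does the same for
  \<open>q3\<close>.\<close>

definition coord2 :: "plane \<Rightarrow> plane \<Rightarrow> plane \<Rightarrow> plane \<Rightarrow> real" where
  "coord2 q1 q2 q3 h = h $ 1 * ((q3 $ 2 - q1 $ 2) / jac q1 q2 q3) - h $ 2 * ((q3 $ 1 - q1 $ 1) / jac q1 q2 q3)"

definition coord3 :: "plane \<Rightarrow> plane \<Rightarrow> plane \<Rightarrow> plane \<Rightarrow> real" where
  "coord3 q1 q2 q3 h = h $ 2 * ((q2 $ 1 - q1 $ 1) / jac q1 q2 q3) - h $ 1 * ((q2 $ 2 - q1 $ 2) / jac q1 q2 q3)"

lemma coord_decomp:
  assumes "jac q1 q2 q3 \<noteq> 0"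
  shows "h = coord2 q1 q2 q3 h *\<^sub>R (q2 - q1) + coord3 q1 q2 q3 h *\<^sub>R (q3 - q1)"
proof -
  have c: "jac q1 q2 q3 * coord2 q1 q2 q3 h = h $ 1 * (q3 $ 2 - q1 $ 2) - h $ 2 * (q3 $ 1 - q1 $ 1)"
    "jac q1 q2 q3 * coord3 q1 q2 q3 h = h $ 2 * (q2 $ 1 - q1 $ 1) - h $ 1 * (q2 $ 2 - q1 $ 2)"
    using assms by (simp_all add: coord2_def coord3_def field_simps)
  have "jac q1 q2 q3 * h $ i = (jac q1 q2 q3 * coord2 q1 q2 q3 h) * (q2 $ i - q1 $ i)
      + (jac q1 q2 q3 * coord3 q1 q2 q3 h) * (q3 $ i - q1 $ i)" for i
    unfolding c unfolding jac_def using exhaust_2[of i] by (auto simp: algebra_simps)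
  then have "jac q1 q2 q3 * h $ i = jac q1 q2 q3 * (coord2 q1 q2 q3 h *\<^sub>R (q2 - q1) + coord3 q1 q2 q3 h *\<^sub>R (q3 - q1)) $ i" for i
    by (simp add: distrib_left)
  then show ?thesis
    using assms by (simp add: vec_eq_iff)
qed

lemma coord_linear: "linear (coord2 q1 q2 q3)" "linear (coord3 q1 q2 q3)"
proof -
  have "linear (\<lambda>h::plane. h $ i * c - h $ j * d)" for i j c d
    by (auto intro!: linearI simp: algebra_simps)
  then show "linear (coord2 q1 q2 q3)" "linear (coord3 q1 q2 q3)"
    unfolding coord2_def[abs_def] coord3_def[abs_def] by blast+
qed

text \<open>Composed with the segment from \<open>x\<close> to \<open>y\<close>, which stays in
  \<open>T\<close>, both derivatives yield the one-sided derivative at 0 of the same real function,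
  and that is unique.\<close>

lemma has_derivative_within_convex_unique:
  fixes f :: "'a::real_normed_vector \<Rightarrow> real"
  assumes "convex T" "x \<in> T" "y \<in> T"
    and D: "(f has_derivative D) (at x within T)" "(f has_derivative D') (at x within T)"
  shows "D (y - x) = D' (y - x)"
proof -
  define \<gamma> where "\<gamma> t = x + t *\<^sub>R (y - x)" for t :: real
  have \<gamma>T: "\<gamma> ` {0..1} \<subseteq> T"
    using assms(1-3) by (auto simp: \<gamma>_def convex_alt algebra_simps)
  have \<gamma>': "(\<gamma> has_vector_derivative (y - x)) (at 0 within {0..1})"
    unfolding \<gamma>_def by (auto intro!: derivative_eq_intros)
  have "((f \<circ> \<gamma>) has_vector_derivative E (y - x)) (at 0 within {0..1})"
    if "(f has_derivative E) (at x within T)" for E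
  proof (rule vector_derivative_diff_chain_within[OF \<gamma>'])
    show "(f has_derivative E) (at (\<gamma> 0) within \<gamma> ` {0..1})"
      using has_derivative_subset[OF that \<gamma>T] by (simp add: \<gamma>_def)
  qed
  from this[OF D(1)] this[OF D(2)] show ?thesis
    using vector_derivative_unique_within_closed_interval[of 0 1 0 "f \<circ> \<gamma>"] by (auto simp: cbox_interval)
qed

text \<open>Even at a vertex the vectors from \<open>x\<close> to all three vertices are available,
  and their differences span the plane; linearity does the rest.\<close>

lemma has_derivative_within_triangle_unique:
  fixes f :: "plane \<Rightarrow> real"
  assumes nz: "jac q1 q2 q3 \<noteq> 0" and x: "x \<in> convex hull {q1, q2, q3}"
    and D: "(f has_derivative D) (at x within convex hull {q1, q2, q3})"
      "(f has_derivative D') (at x within convex hull {q1, q2, q3})"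
  shows "D = D'"
proof
  fix h
  have lin: "linear D" "linear D'"
    using D has_derivative_linear by blast+
  have eq: "D (q - x) = D' (q - x)" if "q \<in> {q1, q2, q3}" for q
    using that by (intro has_derivative_within_convex_unique[OF convex_convex_hull x _ D] hull_inc)
  have "q2 - q1 = (q2 - x) - (q1 - x)" "q3 - q1 = (q3 - x) - (q1 - x)"
    by simp_all
  then have "D (q2 - q1) = D' (q2 - q1)" "D (q3 - q1) = D' (q3 - q1)"
    using eq[of q1] eq[of q2] eq[of q3] linear_diff[OF lin(1)] linear_diff[OF lin(2)] by simp_all
  then have "D (a *\<^sub>R (q2 - q1) + b *\<^sub>R (q3 - q1)) = D' (a *\<^sub>R (q2 - q1) + b *\<^sub>R (q3 - q1))" for a b
    by (simp add: linear_add[OF lin(1)] linear_add[OF lin(2)] linear_scale[OF lin(1)] linear_scale[OF lin(2)])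
  then show "D h = D' h"
    using coord_decomp[OF nz, of h] by metis
qed

text \<open>In \<open>g2 x h k\<close> the function is differentiated along \<open>h\<close> first
  and along \<open>k\<close> second. Nothing is said about symmetry, so the two slots are handled
  separately below.\<close>

definition C2_derivs :: "(plane \<Rightarrow> real) \<Rightarrow> (plane \<Rightarrow> plane \<Rightarrow> real) \<Rightarrow> (plane \<Rightarrow> plane \<Rightarrow> plane \<Rightarrow> real) \<Rightarrow> bool" where
  "C2_derivs g g1 g2 \<longleftrightarrow> (\<forall>x. (g has_derivative g1 x) (at x)) \<and>
    (\<forall>x h. ((\<lambda>y. g1 y h) has_derivative g2 x h) (at x))"

lemma frechet_derivative_within_triangle:
  fixes f g :: "plane \<Rightarrow> real"
  assumes nz: "jac q1 q2 q3 \<noteq> 0" and x: "x \<in> convex hull {q1, q2, q3}"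
    and fg: "\<And>y. y \<in> convex hull {q1, q2, q3} \<Longrightarrow> f y = g y" and D: "(g has_derivative D) (at x)"
  shows "frechet_derivative f (at x within convex hull {q1, q2, q3}) = D"
    "f differentiable (at x within convex hull {q1, q2, q3})"
proof -
  have "(g has_derivative D) (at x within convex hull {q1, q2, q3})"
    using D by (rule has_derivative_at_withinI)
  then have fD: "(f has_derivative D) (at x within convex hull {q1, q2, q3})"
    using has_derivative_transform[of x "convex hull {q1, q2, q3}" f g D] x fg by simp
  then show "f differentiable (at x within convex hull {q1, q2, q3})"
    by (auto simp: differentiable_def)
  then show "frechet_derivative f (at x within convex hull {q1, q2, q3}) = D"
    using has_derivative_within_triangle_unique[OF nz x _ fD] by (simp add: frechet_derivative_works)
qed

lemma partials_within_triangle: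
  assumes nz: "jac q1 q2 q3 \<noteq> 0" and C2: "C2_derivs g g1 g2"
    and fg: "\<And>y. y \<in> convex hull {q1, q2, q3} \<Longrightarrow> f y = g y"
  defines "T \<equiv> convex hull {q1, q2, q3}"
  shows "x \<in> T \<Longrightarrow> partials_within T [i] f x = g1 x (axis i 1)"
    and "x \<in> T \<Longrightarrow> partials_within T [i, j] f x = g2 x (axis j 1) (axis i 1)"
    and "r \<le> 2 \<Longrightarrow> partials_exist_along r e T f"
proof -
  have d1: "(g has_derivative g1 x) (at x)" and d2: "((\<lambda>y. g1 y h) has_derivative g2 x h) (at x)" for x h
    using C2 by (auto simp: C2_derivs_def)
  note fr = frechet_derivative_within_triangle[OF nz, folded T_def]
  have fg': "partials_within T [] f y = g y" if "y \<in> T" for y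
    using fg that by (simp add: T_def)
  show 1: "partials_within T [i] f x = g1 x (axis i 1)" if "x \<in> T" for x i
    using fr(1)[OF that fg' d1] by simp
  \<comment> \<open>\<open>partials_within\<close> differentiates by the last list entry first,
    which is why \<open>j\<close> comes before \<open>i\<close> on the right-hand side.\<close>
  show 2: "partials_within T [i, j] f x = g2 x (axis j 1) (axis i 1)" if "x \<in> T" for x i j
    using fr(1)[OF that 1 d2] unfolding partials_within.simps(2)[of T i "[j]"] by simp
  show "partials_exist_along r e T f" if hr: "r \<le> 2"
    unfolding partials_exist_along_def
  proof (intro exI[of _ UNIV] conjI allI impI ballI)
    fix "is" :: "2 list" and x
    assume "length is < r" and x: "x \<in> T \<inter> UNIV"
    then consider "is = []" | i where "is = [i]"
      using hr by (cases "is" rule: remdups_adj.cases) auto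
    then show "partials_within T is f differentiable (at x within T)"
    proof cases
      case 1
      then show ?thesis
        using fr(2)[OF _ fg' d1] x by simp
    next
      case (2 i)
      then show ?thesis
        using fr(2)[OF _ 1 d2] x by blast
    qed
  qed auto
qed

text \<open>Linearity in \<open>h\<close> is not immediate, as \<open>h\<close> is only a parameter
  of the differentiated function. It holds because \<open>g1 y\<close> is linear for every
  \<open>y\<close> and derivatives in the plane are unique.\<close>

lemma C2_derivs_linear:
  assumes "C2_derivs g g1 g2"
  shows "linear (g1 x)" "linear (g2 x h)" "linear (\<lambda>h. g2 x h k)"
proof -
  have d1: "(g has_derivative g1 x) (at x)" and d2: "((\<lambda>y. g1 y h) has_derivative g2 x h) (at x)" for x h
    using assms by (auto simp: C2_derivs_def)
  show lin1: "linear (g1 x)" for x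
    using d1 has_derivative_linear by blast
  show "linear (g2 x h)"
    using d2 has_derivative_linear by blast
  show "linear (\<lambda>h. g2 x h k)"
  proof (rule linearI)
    fix h h' :: plane and c :: real
    have "((\<lambda>y. g1 y h + g1 y h') has_derivative (\<lambda>k. g2 x h k + g2 x h' k)) (at x)"
      by (intro has_derivative_add d2)
    then have "((\<lambda>y. g1 y (h + h')) has_derivative (\<lambda>k. g2 x h k + g2 x h' k)) (at x)"
      by (simp add: linear_add[OF lin1])
    from has_derivative_unique[OF d2 this] show "g2 x (h + h') k = g2 x h k + g2 x h' k"
      by simp
    have "((\<lambda>y. c *\<^sub>R g1 y h) has_derivative (\<lambda>k. c *\<^sub>R g2 x h k)) (at x)"
      by (intro has_derivative_scaleR_right d2)
    then have "((\<lambda>y. g1 y (c *\<^sub>R h)) has_derivative (\<lambda>k. c *\<^sub>R g2 x h k)) (at x)"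
      by (simp add: linear_scale[OF lin1])
    from has_derivative_unique[OF d2 this] show "g2 x (c *\<^sub>R h) k = c *\<^sub>R g2 x h k"
      by simp
  qed
qed

text \<open>Both pairs of vectors are bases of the plane, so either side says
  \<open>L = L'\<close>.\<close>

lemma linear_eq_on_axes_iff:
  fixes L L' :: "plane \<Rightarrow> real"
  assumes lin: "linear L" "linear L'" and nz: "jac q1 q2 q3 \<noteq> 0"
  shows "(\<forall>i. L (axis i 1) = L' (axis i 1)) \<longleftrightarrow> L (q2 - q1) = L' (q2 - q1) \<and> L (q3 - q1) = L' (q3 - q1)"
proof
  assume *: "\<forall>i. L (axis i 1) = L' (axis i 1)"
  have "L h = L' h" for h
  proof -
    have "h = h $ 1 *\<^sub>R axis 1 1 + h $ 2 *\<^sub>R axis 2 1"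
      by (simp add: vec_eq_iff forall_2 axis_def)
    moreover have "L (a *\<^sub>R axis 1 1 + b *\<^sub>R axis 2 1) = L' (a *\<^sub>R axis 1 1 + b *\<^sub>R axis 2 1)" for a b
      using * by (simp add: linear_add[OF lin(1)] linear_add[OF lin(2)] linear_scale[OF lin(1)] linear_scale[OF lin(2)])
    ultimately show ?thesis
      by metis
  qed
  then show "L (q2 - q1) = L' (q2 - q1) \<and> L (q3 - q1) = L' (q3 - q1)"
    by simp
next
  assume *: "L (q2 - q1) = L' (q2 - q1) \<and> L (q3 - q1) = L' (q3 - q1)"
  then have "L (a *\<^sub>R (q2 - q1) + b *\<^sub>R (q3 - q1)) = L' (a *\<^sub>R (q2 - q1) + b *\<^sub>R (q3 - q1))" for a b
    by (simp add: linear_add[OF lin(1)] linear_add[OF lin(2)] linear_scale[OF lin(1)] linear_scale[OF lin(2)])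
  then show "\<forall>i. L (axis i 1) = L' (axis i 1)"
    using coord_decomp[OF nz] by metis
qed

lemma all_lists_length_le_2:
  fixes P :: "'a list \<Rightarrow> bool"
  shows
  "(\<forall>is. length is \<le> 0 \<longrightarrow> P is) \<longleftrightarrow> P []"
  "(\<forall>is. length is \<le> 1 \<longrightarrow> P is) \<longleftrightarrow> P [] \<and> (\<forall>i. P [i])"
  "(\<forall>is. length is \<le> 2 \<longrightarrow> P is) \<longleftrightarrow> P [] \<and> (\<forall>i. P [i]) \<and> (\<forall>i j. P [i, j])"
proof -
  show "(\<forall>is. length is \<le> 0 \<longrightarrow> P is) \<longleftrightarrow> P []"
    by auto
  show "(\<forall>is. length is \<le> 1 \<longrightarrow> P is) \<longleftrightarrow> P [] \<and> (\<forall>i. P [i])"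
  proof (intro iffI conjI allI impI; (elim conjE)?)
    fix "is" :: "'a list" assume "P []" "\<forall>i. P [i]" "length is \<le> 1"
    then show "P is"
      by (cases "is" rule: remdups_adj.cases) auto
  qed auto
  show "(\<forall>is. length is \<le> 2 \<longrightarrow> P is) \<longleftrightarrow> P [] \<and> (\<forall>i. P [i]) \<and> (\<forall>i j. P [i, j])"
  proof (intro iffI conjI allI impI; (elim conjE)?)
    fix "is" :: "'a list" assume "P []" "\<forall>i. P [i]" "\<forall>i j. P [i, j]" "length is \<le> 2"
    then show "P is"
      by (cases "is" rule: remdups_adj.cases) auto
  qed auto
qed

text \<open>The derivatives of the two extensions are compared in a basis adapted to the edge. The
  transversal direction points to \<open>q3'\<close>, so that it has the simplest components in the
  second triangle and the equations come out solved for the second set of coefficients.\<close>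

lemma meet_smoothly_iff:
  fixes f f' g g' :: "plane \<Rightarrow> real" and q1 q2 q3 q3' :: plane
  defines "T \<equiv> convex hull {q1, q2, q3}" and "T' \<equiv> convex hull {q1, q2, q3'}"
  defines "e \<equiv> closed_segment q1 q2"
  assumes nz: "jac q1 q2 q3 \<noteq> 0" and nz': "jac q1 q2 q3' \<noteq> 0"
    and C2: "C2_derivs g g1 g2" and C2': "C2_derivs g' g1' g2'"
    and fg_T: "\<forall>x\<in>T. f x = g x" and fg_T': "\<forall>x\<in>T'. f' x = g' x"
  defines "u \<equiv> q2 - q1" and "v \<equiv> q3' - q1"
  shows "meet_smoothly 0 e T f T' f' \<longleftrightarrow> (\<forall>x\<in>e. g x = g' x)"
    and "meet_smoothly 1 e T f T' f' \<longleftrightarrow> (\<forall>x\<in>e. g x = g' x) \<and>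
      (\<forall>x\<in>e. g1 x u = g1' x u \<and> g1 x v = g1' x v)"
    and "meet_smoothly 2 e T f T' f' \<longleftrightarrow> (\<forall>x\<in>e. g x = g' x) \<and>
      (\<forall>x\<in>e. g1 x u = g1' x u \<and> g1 x v = g1' x v) \<and>
      (\<forall>x\<in>e. g2 x u u = g2' x u u \<and> g2 x u v = g2' x u v \<and> g2 x v u = g2' x v u \<and> g2 x v v = g2' x v v)"
proof -
  note fg = fg_T[rule_format] and fg' = fg_T'[rule_format]
  have eT: "e \<subseteq> T" "e \<subseteq> T'"
    unfolding e_def T_def T'_def segment_convex_hull by (auto intro!: hull_mono)
  have part: "partials_within T [] f x = g x" "partials_within T [i] f x = g1 x (axis i 1)"
      "partials_within T [i, j] f x = g2 x (axis j 1) (axis i 1)"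
    "partials_within T' [] f' x = g' x" "partials_within T' [i] f' x = g1' x (axis i 1)"
      "partials_within T' [i, j] f' x = g2' x (axis j 1) (axis i 1)" if "x \<in> e" for x i j
    using that eT fg fg' partials_within_triangle(1,2)[OF nz C2, folded T_def, OF fg]
      partials_within_triangle(1,2)[OF nz' C2', folded T'_def, OF fg'] by auto
  have ex: "partials_exist_along r e T f" "partials_exist_along r e T' f'" if "r \<le> 2" for r
    using partials_within_triangle(3)[OF nz C2, folded T_def, OF fg that]
      partials_within_triangle(3)[OF nz' C2', folded T'_def, OF fg' that] by auto
  have "(\<forall>i. g1 x (axis i 1) = g1' x (axis i 1)) \<longleftrightarrow> g1 x u = g1' x u \<and> g1 x v = g1' x v" for x
    unfolding u_def v_def
    by (rule linear_eq_on_axes_iff[OF C2_derivs_linear(1)[OF C2] C2_derivs_linear(1)[OF C2'] nz'])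
  moreover have "(\<forall>i. \<forall>x\<in>e. partials_within T [i] f x = partials_within T' [i] f' x) \<longleftrightarrow>
      (\<forall>x\<in>e. \<forall>i. g1 x (axis i 1) = g1' x (axis i 1))"
    by (simp add: part del: partials_within.simps) blast
  ultimately have 1: "(\<forall>i. \<forall>x\<in>e. partials_within T [i] f x = partials_within T' [i] f' x) \<longleftrightarrow>
      (\<forall>x\<in>e. g1 x u = g1' x u \<and> g1 x v = g1' x v)"
    by simp
  have second: "(\<forall>i. g2 x h (axis i 1) = g2' x h (axis i 1)) \<longleftrightarrow> g2 x h u = g2' x h u \<and> g2 x h v = g2' x h v"
    and first: "(\<forall>i. g2 x (axis i 1) h = g2' x (axis i 1) h) \<longleftrightarrow> g2 x u h = g2' x u h \<and> g2 x v h = g2' x v h" for x h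
    unfolding u_def v_def
    by (rule linear_eq_on_axes_iff[OF C2_derivs_linear(2)[OF C2] C2_derivs_linear(2)[OF C2'] nz']
        linear_eq_on_axes_iff[OF C2_derivs_linear(3)[OF C2] C2_derivs_linear(3)[OF C2'] nz'])+
  \<comment> \<open>One slot at a time is changed from the axes to \<open>u\<close> and
    \<open>v\<close>.\<close>
  have 2: "(\<forall>i j. g2 x (axis j 1) (axis i 1) = g2' x (axis j 1) (axis i 1)) \<longleftrightarrow>
      g2 x u u = g2' x u u \<and> g2 x u v = g2' x u v \<and> g2 x v u = g2' x v u \<and> g2 x v v = g2' x v v" for x
    using first[of x u] first[of x v] second[of x "axis _ 1"] by metis
  have 3: "(\<forall>i j. \<forall>x\<in>e. partials_within T [i, j] f x = partials_within T' [i, j] f' x) \<longleftrightarrow>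
      (\<forall>x\<in>e. g2 x u u = g2' x u u \<and> g2 x u v = g2' x u v \<and> g2 x v u = g2' x v u \<and> g2 x v v = g2' x v v)"
    unfolding 2[symmetric] by (simp add: part del: partials_within.simps) blast
  have 0: "(\<forall>x\<in>e. partials_within T [] f x = partials_within T' [] f' x) \<longleftrightarrow> (\<forall>x\<in>e. g x = g' x)"
    by (simp add: part del: partials_within.simps)
  show "meet_smoothly 0 e T f T' f' \<longleftrightarrow> (\<forall>x\<in>e. g x = g' x)"
    unfolding meet_smoothly_def all_lists_length_le_2 0 using ex by auto
  show "meet_smoothly 1 e T f T' f' \<longleftrightarrow> (\<forall>x\<in>e. g x = g' x) \<and>
      (\<forall>x\<in>e. g1 x u = g1' x u \<and> g1 x v = g1' x v)"
    unfolding meet_smoothly_def all_lists_length_le_2 0 1 using ex by auto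
  show "meet_smoothly 2 e T f T' f' \<longleftrightarrow> (\<forall>x\<in>e. g x = g' x) \<and>
      (\<forall>x\<in>e. g1 x u = g1' x u \<and> g1 x v = g1' x v) \<and>
      (\<forall>x\<in>e. g2 x u u = g2' x u u \<and> g2 x u v = g2' x u v \<and> g2 x v u = g2' x v u \<and> g2 x v v = g2' x v v)"
    unfolding meet_smoothly_def all_lists_length_le_2 0 1 3 using ex by auto
qed

section \<open>Derivatives of the basis\<close>

lemma has_derivative_tpow [derivative_intros]:
  fixes g :: "'a::real_normed_vector \<Rightarrow> real"
  assumes "(g has_derivative g') (at x within S)"
  shows "((\<lambda>x. tpow 2 (g x)) has_derivative (\<lambda>h. 2 * tpow 1 (g x) * g' h)) (at x within S)"
    and "((\<lambda>x. tpow 3 (g x)) has_derivative (\<lambda>h. 3 * tpow 2 (g x) * g' h)) (at x within S)"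
  using DERIV_compose_FDERIV[OF DERIV_tpow2[OF DERIV_ident] assms]
    DERIV_compose_FDERIV[OF DERIV_tpow3[OF DERIV_ident] assms] by (simp_all add: mult.commute)

text \<open>\<open>da, db, dw\<close> and \<open>ea, eb, ew\<close> are the increments of the barycentric coordinates \<open>a, b, w\<close> along
  the first and the second direction of differentiation.\<close>

definition corner_D1 :: "real \<Rightarrow> real \<Rightarrow> real" where
  "corner_D1 a da = 6 * tpow 2 (2 * a - 1) * da"

definition edge_D1 :: "real \<Rightarrow> real \<Rightarrow> real \<Rightarrow> real \<Rightarrow> real" where
  "edge_D1 a w da dw = 6 * (tpow 2 (a - w) * (da - dw) - 2 * tpow 2 (2 * a - 1) * da)"

definition double_edge_D1 :: "real \<Rightarrow> real \<Rightarrow> real \<Rightarrow> real \<Rightarrow> real" where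
  "double_edge_D1 a b da db = 6 * b\<^sup>2 * da + 12 * a * b * db - 6 * b\<^sup>2 * db + 6 * tpow 2 (b - a) * (db - da)"

definition inner_D1 :: "real \<Rightarrow> real \<Rightarrow> real \<Rightarrow> real \<Rightarrow> real \<Rightarrow> real \<Rightarrow> real" where
  "inner_D1 a b w da db dw = 12 * (a\<^sup>2 * da - tpow 2 (a - b) * (da - db) - tpow 2 (a - w) * (da - dw) + 2 * tpow 2 (2 * a - 1) * da)"

definition central_D1 :: "real \<Rightarrow> real \<Rightarrow> real \<Rightarrow> real \<Rightarrow> real \<Rightarrow> real \<Rightarrow> real" where
  "central_D1 a b w da db dw = 12 * a * w * da + 6 * a\<^sup>2 * dw - 6 * a\<^sup>2 * da + 6 * (1 - 2 * b)\<^sup>2 * db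
      + 6 * tpow 2 (a - w) * (da - dw) + 6 * tpow 2 (a - b) * (da - db) + 6 * tpow 2 (w - b) * (dw - db)
      - 6 * tpow 2 (2 * a - 1) * da - 6 * tpow 2 (2 * b - 1) * db - 6 * tpow 2 (2 * w - 1) * dw"

definition corner_D2 :: "real \<Rightarrow> real \<Rightarrow> real \<Rightarrow> real" where
  "corner_D2 a da ea = 24 * tpow 1 (2 * a - 1) * da * ea"

definition edge_D2 :: "real \<Rightarrow> real \<Rightarrow> real \<Rightarrow> real \<Rightarrow> real \<Rightarrow> real \<Rightarrow> real" where
  "edge_D2 a w da dw ea ew = 12 * (tpow 1 (a - w) * (da - dw) * (ea - ew) - 4 * tpow 1 (2 * a - 1) * da * ea)"

definition double_edge_D2 :: "real \<Rightarrow> real \<Rightarrow> real \<Rightarrow> real \<Rightarrow> real \<Rightarrow> real \<Rightarrow> real" where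
  "double_edge_D2 a b da db ea eb = 12 * b * (da * eb + db * ea) + 12 * a * db * eb - 12 * b * db * eb + 12 * tpow 1 (b - a) * (db - da) * (eb - ea)"

definition inner_D2 :: "real \<Rightarrow> real \<Rightarrow> real \<Rightarrow> real \<Rightarrow> real \<Rightarrow> real \<Rightarrow> real \<Rightarrow> real \<Rightarrow> real \<Rightarrow> real" where
  "inner_D2 a b w da db dw ea eb ew = 24 * (a * da * ea - tpow 1 (a - b) * (da - db) * (ea - eb) - tpow 1 (a - w) * (da - dw) * (ea - ew) + 4 * tpow 1 (2 * a - 1) * da * ea)"

definition central_D2 :: "real \<Rightarrow> real \<Rightarrow> real \<Rightarrow> real \<Rightarrow> real \<Rightarrow> real \<Rightarrow> real \<Rightarrow> real \<Rightarrow> real \<Rightarrow> real" where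
  "central_D2 a b w da db dw ea eb ew = 12 * w * da * ea + 12 * a * (da * ew + dw * ea) - 12 * a * da * ea - 24 * (1 - 2 * b) * db * eb
      + 12 * tpow 1 (a - w) * (da - dw) * (ea - ew) + 12 * tpow 1 (a - b) * (da - db) * (ea - eb) + 12 * tpow 1 (w - b) * (dw - db) * (ew - eb)
      - 24 * tpow 1 (2 * a - 1) * da * ea - 24 * tpow 1 (2 * b - 1) * db * eb - 24 * tpow 1 (2 * w - 1) * dw * ew"

definition S3_D1 :: "real \<Rightarrow> real \<Rightarrow> real \<Rightarrow> real \<Rightarrow> real \<Rightarrow> real \<Rightarrow> real list" where
  "S3_D1 a b w da db dw =
    [corner_D1 a da, edge_D1 a w da dw, double_edge_D1 a b da db, edge_D1 b w db dw,
     corner_D1 b db, edge_D1 b a db da, double_edge_D1 b w db dw, edge_D1 w a dw da,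
     corner_D1 w dw, edge_D1 w b dw db, double_edge_D1 a w da dw, edge_D1 a b da db,
     inner_D1 a b w da db dw, inner_D1 b a w db da dw, inner_D1 w a b dw da db, central_D1 a b w da db dw]"

definition S3_D2 :: "real \<Rightarrow> real \<Rightarrow> real \<Rightarrow> real \<Rightarrow> real \<Rightarrow> real \<Rightarrow> real \<Rightarrow> real \<Rightarrow> real \<Rightarrow> real list" where
  "S3_D2 a b w da db dw ea eb ew =
    [corner_D2 a da ea, edge_D2 a w da dw ea ew, double_edge_D2 a b da db ea eb, edge_D2 b w db dw eb ew,
     corner_D2 b db eb, edge_D2 b a db da eb ea, double_edge_D2 b w db dw eb ew, edge_D2 w a dw da ew ea,
     corner_D2 w dw ew, edge_D2 w b dw db ew eb, double_edge_D2 a w da dw ea ew, edge_D2 a b da db ea eb,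
     inner_D2 a b w da db dw ea eb ew, inner_D2 b a w db da dw eb ea ew, inner_D2 w a b dw da db ew ea eb, central_D2 a b w da db dw ea eb ew]"

lemma has_derivative_corner:
  fixes a :: "'c::real_normed_vector \<Rightarrow> real"
  assumes [derivative_intros]: "(a has_derivative a') (at x within S)"
  shows "((\<lambda>x. corner_fn (a x)) has_derivative (\<lambda>h. corner_D1 (a x) (a' h))) (at x within S)"
    and "((\<lambda>x. corner_D1 (a x) da) has_derivative (\<lambda>h. corner_D2 (a x) da (a' h))) (at x within S)"
  unfolding corner_fn_def corner_D1_def corner_D2_def
  by (auto intro!: derivative_eq_intros simp: fun_eq_iff algebra_simps power2_eq_square)

lemma has_derivative_edge:
  fixes a w :: "'c::real_normed_vector \<Rightarrow> real"
  assumes [derivative_intros]: "(a has_derivative a') (at x within S)" and [derivative_intros]: "(w has_derivative w') (at x within S)"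
  shows "((\<lambda>x. edge_fn (a x) (w x)) has_derivative (\<lambda>h. edge_D1 (a x) (w x) (a' h) (w' h))) (at x within S)"
    and "((\<lambda>x. edge_D1 (a x) (w x) da dw) has_derivative (\<lambda>h. edge_D2 (a x) (w x) da dw (a' h) (w' h))) (at x within S)"
  unfolding edge_fn_def edge_D1_def edge_D2_def
  by (auto intro!: derivative_eq_intros simp: fun_eq_iff algebra_simps power2_eq_square)

lemma has_derivative_double_edge:
  fixes a b :: "'c::real_normed_vector \<Rightarrow> real"
  assumes [derivative_intros]: "(a has_derivative a') (at x within S)" and [derivative_intros]: "(b has_derivative b') (at x within S)"
  shows "((\<lambda>x. double_edge_fn (a x) (b x)) has_derivative (\<lambda>h. double_edge_D1 (a x) (b x) (a' h) (b' h))) (at x within S)"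
    and "((\<lambda>x. double_edge_D1 (a x) (b x) da db) has_derivative (\<lambda>h. double_edge_D2 (a x) (b x) da db (a' h) (b' h))) (at x within S)"
  unfolding double_edge_fn_def double_edge_D1_def double_edge_D2_def
  by (auto intro!: derivative_eq_intros simp: fun_eq_iff algebra_simps power2_eq_square)

lemma has_derivative_inner:
  fixes a b w :: "'c::real_normed_vector \<Rightarrow> real"
  assumes [derivative_intros]: "(a has_derivative a') (at x within S)" and [derivative_intros]: "(b has_derivative b') (at x within S)" and [derivative_intros]: "(w has_derivative w') (at x within S)"
  shows "((\<lambda>x. inner_fn (a x) (b x) (w x)) has_derivative (\<lambda>h. inner_D1 (a x) (b x) (w x) (a' h) (b' h) (w' h))) (at x within S)"
    and "((\<lambda>x. inner_D1 (a x) (b x) (w x) da db dw) has_derivative (\<lambda>h. inner_D2 (a x) (b x) (w x) da db dw (a' h) (b' h) (w' h))) (at x within S)"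
  unfolding inner_fn_def inner_D1_def inner_D2_def
  by (auto intro!: derivative_eq_intros simp: fun_eq_iff algebra_simps power2_eq_square)

lemma has_derivative_central:
  fixes a b w :: "'c::real_normed_vector \<Rightarrow> real"
  assumes [derivative_intros]: "(a has_derivative a') (at x within S)" and [derivative_intros]: "(b has_derivative b') (at x within S)" and [derivative_intros]: "(w has_derivative w') (at x within S)"
  shows "((\<lambda>x. central_fn (a x) (b x) (w x)) has_derivative (\<lambda>h. central_D1 (a x) (b x) (w x) (a' h) (b' h) (w' h))) (at x within S)"
    and "((\<lambda>x. central_D1 (a x) (b x) (w x) da db dw) has_derivative (\<lambda>h. central_D2 (a x) (b x) (w x) da db dw (a' h) (b' h) (w' h))) (at x within S)"
  unfolding central_fn_def central_D1_def central_D2_def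
  by (auto intro!: derivative_eq_intros simp: fun_eq_iff algebra_simps power2_eq_square)

lemma has_derivative_S3_bary:
  fixes a b w :: "'c::real_normed_vector \<Rightarrow> real"
  assumes "(a has_derivative a') (at x within S)" "(b has_derivative b') (at x within S)"
    "(w has_derivative w') (at x within S)" and "j < 16"
  shows "((\<lambda>x. S3_bary (a x) (b x) (w x) ! j) has_derivative
      (\<lambda>h. S3_D1 (a x) (b x) (w x) (a' h) (b' h) (w' h) ! j)) (at x within S)" (is ?A)
    and "((\<lambda>x. S3_D1 (a x) (b x) (w x) da db dw ! j) has_derivative
      (\<lambda>h. S3_D2 (a x) (b x) (w x) da db dw (a' h) (b' h) (w' h) ! j)) (at x within S)" (is ?B)
proof -
  have "j \<in> {0, 1, 2, 3, 4, 5, 6, 7, 8, 9, 10, 11, 12, 13, 14, 15}"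
    unfolding insert_iff empty_iff using assms(4) by presburger
  then show ?A ?B
    unfolding S3_bary_def S3_D1_def S3_D2_def insert_iff empty_iff
    by (elim disjE FalseE; simp; intro has_derivative_corner has_derivative_edge has_derivative_double_edge has_derivative_inner has_derivative_central assms)+
qed

section \<open>Splines with reordered coefficients as functions on the plane\<close>

definition reordered_sum :: "(nat \<Rightarrow> real) \<Rightarrow> real list \<Rightarrow> real" where
  "reordered_sum c L = (\<Sum>i=1..16. c i * L ! (reorder i - 1))"

text \<open>Coefficients count from 1 and list positions from 0, so \<open>c i\<close> multiplies
  entry \<open>reorder i - 1\<close>. The same sum serves the values and both derivative lists,
  which share one order.\<close>

lemma reordered_sum_expand:
  "reordered_sum c L = c 1 * L ! 0 + c 2 * L ! 1 + c 3 * L ! 2 + c 4 * L ! 3 + c 5 * L ! 4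
    + c 6 * L ! 11 + c 7 * L ! 12 + c 8 * L ! 13 + c 9 * L ! 5 + c 10 * L ! 10 + c 11 * L ! 15
    + c 12 * L ! 6 + c 13 * L ! 14 + c 14 * L ! 9 + c 15 * L ! 7 + c 16 * L ! 8"
proof -
  have "{1..16::nat} = {1, 2, 3, 4, 5, 6, 7, 8, 9, 10, 11, 12, 13, 14, 15, 16}"
    unfolding set_eq_iff insert_iff empty_iff atLeastAtMost_iff by presburger
  then show ?thesis
    unfolding reordered_sum_def by (simp add: reorder_def)
qed

lemma reorder_less: "i \<in> {1..16} \<Longrightarrow> reorder i - 1 < 16"
proof -
  assume "i \<in> {1..16}"
  then have "i \<in> {1, 2, 3, 4, 5, 6, 7, 8, 9, 10, 11, 12, 13, 14, 15, 16}"
    unfolding insert_iff empty_iff atLeastAtMost_iff by presburger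
  then show ?thesis
    by (auto simp: reorder_def)
qed

text \<open>Here the barycentric coordinates are affine functions on the whole plane, with negative
  values outside the triangle. Composed with the closed forms they give the extension.\<close>

locale plane_triangle =
  fixes q1 q2 q3 :: plane
  assumes nz: "jac q1 q2 q3 \<noteq> 0"
begin

definition bx :: "plane \<Rightarrow> real" where "bx x = coord2 q1 q2 q3 (x - q1)"
definition wx :: "plane \<Rightarrow> real" where "wx x = coord3 q1 q2 q3 (x - q1)"
definition ax :: "plane \<Rightarrow> real" where "ax x = 1 - bx x - wx x"

abbreviation "db \<equiv> coord2 q1 q2 q3"
abbreviation "dw \<equiv> coord3 q1 q2 q3"
abbreviation "da h \<equiv> - db h - dw h"

lemma coords_bary:
  assumes "a + b + w = 1"
  shows "ax (bary q1 q2 q3 a b w) = a" "bx (bary q1 q2 q3 a b w) = b" "wx (bary q1 q2 q3 a b w) = w"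
proof -
  let ?h = "bary q1 q2 q3 a b w - q1"
  have "a = 1 - b - w"
    using assms by simp
  then have h: "?h = b *\<^sub>R (q2 - q1) + w *\<^sub>R (q3 - q1)"
    unfolding bary_def by (simp only:) (simp add: algebra_simps)
  have "pt q1 q2 q3 (db ?h) (dw ?h) = pt q1 q2 q3 b w"
    using coord_decomp[OF nz, of ?h] unfolding h pt_def by (simp add: add.assoc)
  from pt_inj[OF nz this] show "bx (bary q1 q2 q3 a b w) = b" "wx (bary q1 q2 q3 a b w) = w"
    by (simp_all add: bx_def wx_def)
  then show "ax (bary q1 q2 q3 a b w) = a"
    using assms by (simp add: ax_def)
qed

lemma coord_dirs:
  "db (b *\<^sub>R (q2 - q1) + w *\<^sub>R (q3 - q1)) = b" "dw (b *\<^sub>R (q2 - q1) + w *\<^sub>R (q3 - q1)) = w"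
proof -
  have "bary q1 q2 q3 (1 - b - w) b w - q1 = b *\<^sub>R (q2 - q1) + w *\<^sub>R (q3 - q1)"
    by (simp add: bary_def algebra_simps)
  then show "db (b *\<^sub>R (q2 - q1) + w *\<^sub>R (q3 - q1)) = b" "dw (b *\<^sub>R (q2 - q1) + w *\<^sub>R (q3 - q1)) = w"
    using coords_bary(2,3)[of "1 - b - w" b w] by (simp_all add: bx_def wx_def)
qed

definition spline_ext :: "(nat \<Rightarrow> real) \<Rightarrow> plane \<Rightarrow> real" where
  "spline_ext c x = reordered_sum c (S3_bary (ax x) (bx x) (wx x))"

definition spline_D1 :: "(nat \<Rightarrow> real) \<Rightarrow> plane \<Rightarrow> plane \<Rightarrow> real" where
  "spline_D1 c x h = reordered_sum c (S3_D1 (ax x) (bx x) (wx x) (da h) (db h) (dw h))"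

definition spline_D2 :: "(nat \<Rightarrow> real) \<Rightarrow> plane \<Rightarrow> plane \<Rightarrow> plane \<Rightarrow> real" where
  "spline_D2 c x h k = reordered_sum c (S3_D2 (ax x) (bx x) (wx x) (da h) (db h) (dw h) (da k) (db k) (dw k))"

lemma coords_has_derivative:
  "(bx has_derivative db) (at x)" "(wx has_derivative dw) (at x)" "(ax has_derivative da) (at x)"
proof -
  have lin: "(db has_derivative db) (at y)" "(dw has_derivative dw) (at y)" for y
    using coord_linear by (auto intro!: bounded_linear_imp_has_derivative simp: linear_conv_bounded_linear)
  have sub: "((\<lambda>x. x - q1) has_derivative (\<lambda>h. h)) (at x)"
    by (auto intro!: derivative_eq_intros)
  show b: "(bx has_derivative db) (at x)"
    unfolding bx_def[abs_def] using has_derivative_compose[OF sub lin(1)] .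
  show w: "(wx has_derivative dw) (at x)"
    unfolding wx_def[abs_def] using has_derivative_compose[OF sub lin(2)] .
  show "(ax has_derivative da) (at x)"
    unfolding ax_def[abs_def] by (auto intro!: derivative_eq_intros b w)
qed

lemma spline_C2: "C2_derivs (spline_ext c) (spline_D1 c) (spline_D2 c)"
  unfolding C2_derivs_def spline_ext_def[abs_def] spline_D1_def[abs_def] spline_D2_def[abs_def] reordered_sum_def
  by (intro conjI allI has_derivative_sum has_derivative_mult_right has_derivative_S3_bary
      coords_has_derivative reorder_less)

lemma mem_triangle_bary:
  assumes "x \<in> convex hull {q1, q2, q3}"
  obtains a b w where "0 \<le> a" "0 \<le> b" "0 \<le> w" "a + b + w = 1" "x = bary q1 q2 q3 a b w"
  using assms unfolding convex_hull_3 bary_def by blast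

lemma S3_sum_eq_spline_ext:
  assumes "x \<in> convex hull {q1, q2, q3}"
  shows "(\<Sum>i=1..16. c i * S3 q1 q2 q3 (reorder i) x) = spline_ext c x"
proof -
  obtain a b w where *: "0 \<le> a" "0 \<le> b" "0 \<le> w" "a + b + w = 1" "x = bary q1 q2 q3 a b w"
    using mem_triangle_bary[OF assms] .
  then show ?thesis
    by (simp add: S3_def spline_ext_def reordered_sum_def S3_list_bary[OF nz] coords_bary)
qed

lemma edge_coords:
  shows "bx ((1 - t) *\<^sub>R q1 + t *\<^sub>R q2) = t" "wx ((1 - t) *\<^sub>R q1 + t *\<^sub>R q2) = 0" "ax ((1 - t) *\<^sub>R q1 + t *\<^sub>R q2) = 1 - t"
  using coords_bary[of "1 - t" t 0] by (simp_all add: bary_def)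

end

section \<open>Jets along the common edge\<close>

text \<open>A direction is given by its components \<open>(u, v)\<close> along the edge and along the side \<open>q3 - q1\<close> of the
  triangle in question: \<open>p3' - p1\<close> is \<open>(\<beta>2, \<beta>3)\<close> for the first triangle and \<open>(0, 1)\<close> for the
  second.\<close>

definition edge_jet0 :: "(nat \<Rightarrow> real) \<Rightarrow> real \<Rightarrow> real" where
  "edge_jet0 c t = reordered_sum c (S3_bary (1 - t) t 0)"

definition edge_jet1 :: "(nat \<Rightarrow> real) \<Rightarrow> real \<Rightarrow> real \<Rightarrow> real \<Rightarrow> real" where
  "edge_jet1 c t u v = reordered_sum c (S3_D1 (1 - t) t 0 (- u - v) u v)"

definition edge_jet2 :: "(nat \<Rightarrow> real) \<Rightarrow> real \<Rightarrow> real \<Rightarrow> real \<Rightarrow> real \<Rightarrow> real \<Rightarrow> real" where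
  "edge_jet2 c t u v u' v' = reordered_sum c (S3_D2 (1 - t) t 0 (- u - v) u v (- u' - v') u' v')"

text \<open>Of the interior lines only \<open>a = b\<close>, \<open>2 * a = 1\<close> and
  \<open>2 * b = 1\<close> cross the open edge, all at its midpoint; every other truncated power
  becomes zero or a plain power on the edge. The condition \<open>0 < n\<close> matters because
  \<open>tpow 0\<close> is constantly 1.\<close>

lemma tpow_edge:
  assumes "0 \<le> t" "t \<le> 1" "0 < n"
  shows "tpow n t = t ^ n" "tpow n (1 - t) = (1 - t) ^ n" "tpow n (- t) = 0" "tpow n (t - 1) = 0"
    "tpow n (- 1) = 0" "tpow n (2 * (1 - t) - 1) = tpow n (1 - 2 * t)"
    "tpow n (1 - t - t) = tpow n (1 - 2 * t)" "tpow n (t - (1 - t)) = tpow n (2 * t - 1)"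
  using assms by (simp_all add: tpow_def max_def)

lemmas jet_expand = reordered_sum_expand S3_bary_def S3_D1_def S3_D2_def corner_fn_def edge_fn_def double_edge_fn_def
    inner_fn_def central_fn_def corner_D1_def edge_D1_def double_edge_D1_def inner_D1_def central_D1_def
    corner_D2_def edge_D2_def double_edge_D2_def inner_D2_def central_D2_def

lemma edge_jet0_expand:
  assumes "0 \<le> t" "t \<le> 1"
  shows "edge_jet0 c t = c 1 * tpow 3 (1 - 2 * t) + c 2 * (2 * (1 - t) ^ 3 - 2 * tpow 3 (1 - 2 * t))
    + c 3 * (6 * (1 - t) * t\<^sup>2 - 2 * t ^ 3 + 2 * tpow 3 (2 * t - 1))
    + c 4 * (2 * t ^ 3 - 2 * tpow 3 (2 * t - 1)) + c 5 * tpow 3 (2 * t - 1)"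
proof -
  \<comment> \<open>This relation between the two truncated cubes makes the central function vanish
    on the edge, so that \<open>c 11\<close> drops out.\<close>
  have "tpow 3 (1 - 2 * t) = (1 - 2 * t) ^ 3 + tpow 3 (2 * t - 1)"
    by (simp add: tpow_def max_def power3_eq_cube algebra_simps)
  then have "2 * (1 - t) ^ 3 + (1 - 2 * t) ^ 3 = tpow 3 (1 - 2 * t) - tpow 3 (2 * t - 1) + 2 * (1 - t) ^ 3"
    by simp
  then show ?thesis
    unfolding edge_jet0_def jet_expand using tpow_edge[OF assms, of 3] by simp
qed

text \<open>The terms of \<open>c 6\<close> to \<open>c 9\<close> carry the factor \<open>v\<close>:
  their functions vanish on the edge, so only the transversal component sees them. The functions of
  \<open>c 10\<close> to \<open>c 16\<close> have zero gradient there.\<close>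

lemma edge_jet1_expand:
  assumes "0 \<le> t" "t \<le> 1"
  defines "s \<equiv> tpow 2 (1 - 2 * t)" and "r \<equiv> tpow 2 (2 * t - 1)"
  shows "edge_jet1 c t u v = c 1 * (- 6 * s * (u + v))
    + c 2 * (6 * (2 * s * (u + v) - (1 - t)\<^sup>2 * (u + 2 * v)))
    + c 3 * (12 * (1 - t) * t * u - 6 * t\<^sup>2 * (2 * u + v) + 6 * r * (2 * u + v))
    + c 4 * (6 * (t\<^sup>2 * (u - v) - 2 * r * u)) + c 5 * (6 * r * u)
    + c 6 * (6 * s * v) + c 7 * (12 * ((1 - t)\<^sup>2 - s) * v)
    + c 8 * (12 * (t\<^sup>2 - r) * v) + c 9 * (6 * r * v)"
proof -
  have "s = (1 - 2 * t)\<^sup>2 - r"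
    by (simp add: s_def r_def tpow_def max_def power2_eq_square algebra_simps)
  then show ?thesis
    unfolding edge_jet1_def jet_expand using tpow_edge[OF assms(1,2), of 2]
    by (simp add: s_def[symmetric] r_def[symmetric]) (simp add: algebra_simps power2_eq_square)
qed

text \<open>The same hierarchy one order up: \<open>c 10\<close> to \<open>c 12\<close> enter only
  through \<open>v * v'\<close>, and \<open>c 6\<close> to \<open>c 9\<close> need at least one
  transversal component.\<close>

lemma edge_jet2_expand:
  assumes "0 \<le> t" "t \<le> 1"
  defines "s \<equiv> tpow 1 (1 - 2 * t)" and "r \<equiv> tpow 1 (2 * t - 1)"
  shows "edge_jet2 c t u v u' v' = c 1 * (24 * s * ((u + v) * (u' + v')))
    + c 2 * (12 * ((1 - t) * ((u + 2 * v) * (u' + 2 * v')) - 4 * s * ((u + v) * (u' + v'))))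
    + c 3 * (12 * (1 - t) * (u * u') - 12 * t * (u * u' + (u + v) * u' + u * (u' + v')) + 12 * r * ((2 * u + v) * (2 * u' + v')))
    + c 4 * (12 * (t * ((u - v) * (u' - v')) - 4 * r * (u * u'))) + c 5 * (24 * r * (u * u'))
    - c 6 * (12 * s * (2 * u * v' + 2 * v * u' + 3 * v * v'))
    + c 7 * (24 * (s * (2 * u * v' + 2 * v * u' + 3 * v * v') - (1 - t) * (u * v' + v * u' + 3 * v * v')))
    + c 8 * (24 * (t * (u * v' + v * u' - v * v') - r * (2 * u * v' + 2 * v * u' + v * v')))
    + c 9 * (12 * r * (2 * u * v' + 2 * v * u' + v * v'))
    + c 10 * (12 * (1 - t) * v * v') + c 11 * (12 * (1 - t - s) * v * v') + c 12 * (12 * t * v * v')"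
proof -
  have "s = 1 - 2 * t + r"
    by (simp add: s_def r_def tpow_def max_def)
  then show ?thesis
    unfolding edge_jet2_def jet_expand using tpow_edge[OF assms(1,2), of 1]
    by (simp add: s_def[symmetric, simplified] r_def[symmetric, simplified]) (simp add: algebra_simps)
qed

section \<open>Equality of jets as equations for the coefficients\<close>

lemma edge_jet0_eq_iff:
  "(\<forall>t\<in>{0..1}. edge_jet0 c t = edge_jet0 c' t) \<longleftrightarrow>
    c' 1 = c 1 \<and> c' 2 = c 2 \<and> c' 3 = c 3 \<and> c' 4 = c 4 \<and> c' 5 = c 5"
proof
  assume *: "\<forall>t\<in>{0..1}. edge_jet0 c t = edge_jet0 c' t"
  \<comment> \<open>The ends give the first and the fifth coefficient; the three inner values form a
    nonsingular linear system for the others.\<close>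
  from *[rule_format, of 0] *[rule_format, of "1/4"] *[rule_format, of "1/2"] *[rule_format, of "3/4"] *[rule_format, of 1]
  show "c' 1 = c 1 \<and> c' 2 = c 2 \<and> c' 3 = c 3 \<and> c' 4 = c 4 \<and> c' 5 = c 5"
    by (simp add: edge_jet0_expand tpow_def power2_eq_square power3_eq_cube)
qed (simp add: edge_jet0_expand)

text \<open>Jets of higher order contain the lower coefficients as well, so each equivalence is
  proved under the equations of the orders below it.\<close>

locale C0_edge =
  fixes c c' :: "nat \<Rightarrow> real" and \<beta>1 \<beta>2 \<beta>3 :: real
  assumes sum_\<beta>: "\<beta>1 + \<beta>2 + \<beta>3 = 1"
    and C0: "c' 1 = c 1" "c' 2 = c 2" "c' 3 = c 3" "c' 4 = c 4" "c' 5 = c 5"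
begin

text \<open>In the direction \<open>(1, 0)\<close> only \<open>c 1\<close> to \<open>c 5\<close>
  contribute. In the transversal direction \<open>t = 0\<close> isolates coefficient 6 and
  \<open>t = 1\<close> coefficient 9; then \<open>t = 1/4\<close> and \<open>t = 1/2\<close> give
  two independent equations for 7 and 8.\<close>

lemma edge_jet1_eq_iff:
  "(\<forall>t\<in>{0..1}. edge_jet1 c t 1 0 = edge_jet1 c' t 1 0 \<and> edge_jet1 c t \<beta>2 \<beta>3 = edge_jet1 c' t 0 1) \<longleftrightarrow>
    c' 6 = \<beta>1 * c 1 + \<beta>2 * c 2 + \<beta>3 * c 6 \<and>
    c' 7 = \<beta>1 * c 2 + \<beta>2 * ((c 2 + c 3) / 2) + \<beta>3 * c 7 \<and>
    c' 9 = \<beta>1 * c 4 + \<beta>2 * c 5 + \<beta>3 * c 9 \<and>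
    c' 8 = \<beta>2 * c 4 + \<beta>1 * ((c 3 + c 4) / 2) + \<beta>3 * c 8" (is "?L \<longleftrightarrow> ?R")
proof
  have \<beta>1: "\<beta>1 = 1 - \<beta>2 - \<beta>3"
    using sum_\<beta> by simp
  assume *: ?L
  have 0: "c' 6 = \<beta>1 * c 1 + \<beta>2 * c 2 + \<beta>3 * c 6" "c' 9 = \<beta>1 * c 4 + \<beta>2 * c 5 + \<beta>3 * c 9"
    using *[rule_format, of 0] *[rule_format, of 1]
    by (simp_all add: edge_jet1_expand tpow_def C0 \<beta>1 algebra_simps del: One_nat_def)
  have "edge_jet1 c (1/4) \<beta>2 \<beta>3 = edge_jet1 c' (1/4) 0 1" "edge_jet1 c (1/2) \<beta>2 \<beta>3 = edge_jet1 c' (1/2) 0 1"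
    using *[rule_format, of "1/4"] *[rule_format, of "1/2"] by simp_all
  then have "c' 7 = \<beta>1 * c 2 + \<beta>2 * ((c 2 + c 3) / 2) + \<beta>3 * c 7 \<and> c' 8 = \<beta>2 * c 4 + \<beta>1 * ((c 3 + c 4) / 2) + \<beta>3 * c 8"
    using 0 unfolding \<beta>1
    by (simp add: edge_jet1_expand tpow_def C0 power2_eq_square del: One_nat_def)
      (simp add: field_simps del: One_nat_def; linarith)
  with 0 show ?R
    by simp
next
  have \<beta>1: "\<beta>1 = 1 - \<beta>2 - \<beta>3"
    using sum_\<beta> by simp
  assume R: ?R
  show ?L
  proof (intro ballI conjI)
    fix t :: real assume t: "t \<in> {0..1}"
    \<comment> \<open>With one truncated square eliminated, both sides are polynomials in
      \<open>t\<close> and the remaining one, and the equality is purely algebraic.\<close>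
    have s: "tpow 2 (1 - 2 * t) = (1 - 2 * t)\<^sup>2 - tpow 2 (2 * t - 1)"
      by (simp add: tpow_def max_def power2_eq_square algebra_simps)
    show "edge_jet1 c t 1 0 = edge_jet1 c' t 1 0"
      using t C0 by (simp add: edge_jet1_expand del: One_nat_def)
    show "edge_jet1 c t \<beta>2 \<beta>3 = edge_jet1 c' t 0 1"
      using t R C0 unfolding \<beta>1 by (simp add: edge_jet1_expand s del: One_nat_def) (simp add: field_simps power2_eq_square del: One_nat_def)
  qed
qed

end

locale C1_edge = C0_edge +
  assumes C1: "c' 6 = \<beta>1 * c 1 + \<beta>2 * c 2 + \<beta>3 * c 6"
    "c' 7 = \<beta>1 * c 2 + \<beta>2 * ((c 2 + c 3) / 2) + \<beta>3 * c 7"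
    "c' 9 = \<beta>1 * c 4 + \<beta>2 * c 5 + \<beta>3 * c 9"
    "c' 8 = \<beta>2 * c 4 + \<beta>1 * ((c 3 + c 4) / 2) + \<beta>3 * c 8"
begin

text \<open>The tangential and mixed equalities are edge derivatives of identities of lower order
  and follow from the equations of \<open>C0\<close> and \<open>C1\<close> alone. In the transversal
  one, \<open>t = 0\<close> isolates coefficient 10, \<open>t = 1\<close> coefficient 12, and
  \<open>t = 1/2\<close> then yields 11.\<close>

lemma edge_jet2_eq_iff:
  "(\<forall>t\<in>{0..1}. edge_jet2 c t 1 0 1 0 = edge_jet2 c' t 1 0 1 0 \<and>
      edge_jet2 c t 1 0 \<beta>2 \<beta>3 = edge_jet2 c' t 1 0 0 1 \<and>
      edge_jet2 c t \<beta>2 \<beta>3 1 0 = edge_jet2 c' t 0 1 1 0 \<and>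
      edge_jet2 c t \<beta>2 \<beta>3 \<beta>2 \<beta>3 = edge_jet2 c' t 0 1 0 1) \<longleftrightarrow>
    c' 10 = 2 * \<beta>1 * \<beta>2 * ((3 * c 2 - c 1) / 2) + 2 * \<beta>1 * \<beta>3 * ((3 * c 6 - c 1) / 2)
           + 2 * \<beta>2 * \<beta>3 * ((4 * c 7 - c 2 - c 6) / 2)
           + \<beta>1\<^sup>2 * c 1 + \<beta>2\<^sup>2 * c 3 + \<beta>3\<^sup>2 * c 10 \<and>
    c' 12 = 2 * \<beta>1 * \<beta>2 * ((3 * c 4 - c 5) / 2) + 2 * \<beta>2 * \<beta>3 * ((3 * c 9 - c 5) / 2)
           + 2 * \<beta>1 * \<beta>3 * ((4 * c 8 - c 4 - c 9) / 2)
           + \<beta>1\<^sup>2 * c 3 + \<beta>2\<^sup>2 * c 5 + \<beta>3\<^sup>2 * c 12 \<and>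
    c' 11 = 2 * \<beta>1 * \<beta>2 * ((c 1 - 2 * c 2 + 4 * c 3 - 2 * c 4 + c 5) / 2) + \<beta>3\<^sup>2 * c 11
           + 2 * \<beta>1 * \<beta>3 * ((c 1 - 2 * c 2 + c 3 - 3 * c 6 + 6 * c 7 - 2 * c 8 + c 9) / 2)
           + \<beta>2\<^sup>2 * (2 * c 4 - c 5)
           + 2 * \<beta>2 * \<beta>3 * ((c 3 - 2 * c 4 + c 5 - 3 * c 9 + 6 * c 8 - 2 * c 7 + c 6) / 2)
           + \<beta>1\<^sup>2 * (2 * c 2 - c 1)" (is "?L \<longleftrightarrow> c' 10 = ?r10 \<and> c' 12 = ?r12 \<and> c' 11 = ?r11")
proof
  have \<beta>1: "\<beta>1 = 1 - \<beta>2 - \<beta>3"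
    using sum_\<beta> by simp
  assume *: ?L
  have 10: "c' 10 = ?r10"
    using *[rule_format, of 0] unfolding \<beta>1
    by (simp add: edge_jet2_expand tpow_def C0 C1 \<beta>1 del: One_nat_def) (simp add: field_simps power2_eq_square del: One_nat_def; linarith)
  have 12: "c' 12 = ?r12"
    using *[rule_format, of 1] unfolding \<beta>1
    by (simp add: edge_jet2_expand tpow_def C0 C1 \<beta>1 del: One_nat_def) (simp add: field_simps power2_eq_square del: One_nat_def; linarith)
  have "edge_jet2 c (1/2) \<beta>2 \<beta>3 \<beta>2 \<beta>3 = edge_jet2 c' (1/2) 0 1 0 1"
    using *[rule_format, of "1/2"] by simp
  then have "c' 11 = ?r11"
    unfolding \<beta>1 by (simp add: edge_jet2_expand tpow_def C0 C1 10 12 \<beta>1 del: One_nat_def) (simp add: field_simps power2_eq_square del: One_nat_def; linarith)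
  with 10 12 show "c' 10 = ?r10 \<and> c' 12 = ?r12 \<and> c' 11 = ?r11"
    by simp
next
  have \<beta>1: "\<beta>1 = 1 - \<beta>2 - \<beta>3"
    using sum_\<beta> by simp
  assume "c' 10 = ?r10 \<and> c' 12 = ?r12 \<and> c' 11 = ?r11"
  then have R: "c' 10 = ?r10" "c' 12 = ?r12" "c' 11 = ?r11"
    by blast+
  show ?L
  proof (intro ballI)
    fix t :: real assume t: "t \<in> {0..1}"
    have s: "tpow 1 (1 - 2 * t) = 1 - 2 * t + tpow 1 (2 * t - 1)"
      by (simp add: tpow_def max_def)
    define r where "r = tpow 1 (2 * t - 1)"
    have 1: "edge_jet2 c t 1 0 1 0 = edge_jet2 c' t 1 0 1 0"
      using t by (simp add: edge_jet2_expand C0 del: One_nat_def)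
    have 2: "edge_jet2 c t 1 0 \<beta>2 \<beta>3 = edge_jet2 c' t 1 0 0 1" "edge_jet2 c t \<beta>2 \<beta>3 1 0 = edge_jet2 c' t 0 1 1 0"
      using t unfolding edge_jet2_expand[OF t[unfolded atLeastAtMost_iff, THEN conjunct1] t[unfolded atLeastAtMost_iff, THEN conjunct2]]
        s r_def[symmetric] C0 C1 \<beta>1 by (simp_all add: field_simps power2_eq_square del: One_nat_def)
    have 3: "edge_jet2 c t \<beta>2 \<beta>3 \<beta>2 \<beta>3 = edge_jet2 c' t 0 1 0 1"
      using t unfolding edge_jet2_expand[OF t[unfolded atLeastAtMost_iff, THEN conjunct1] t[unfolded atLeastAtMost_iff, THEN conjunct2]]
        s r_def[symmetric] C0 C1 R \<beta>1 by (simp add: field_simps power2_eq_square del: One_nat_def)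
    show "edge_jet2 c t 1 0 1 0 = edge_jet2 c' t 1 0 1 0 \<and>
      edge_jet2 c t 1 0 \<beta>2 \<beta>3 = edge_jet2 c' t 1 0 0 1 \<and>
      edge_jet2 c t \<beta>2 \<beta>3 1 0 = edge_jet2 c' t 0 1 1 0 \<and>
      edge_jet2 c t \<beta>2 \<beta>3 \<beta>2 \<beta>3 = edge_jet2 c' t 0 1 0 1"
      using 1 2 3 by blast
  qed
qed

end

section \<open>Assembly of the three equivalences\<close>

lemma jac_nonzero:
  assumes "\<not> collinear {q1, q2, q3}"
  shows "jac q1 q2 q3 \<noteq> 0"
proof
  assume jac: "jac q1 q2 q3 = 0"
  define h k where "h = q2 - q1" and "k = q3 - q1"
  have hk: "h $ 1 * k $ 2 = h $ 2 * k $ 1"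
    using jac by (simp add: jac_def h_def k_def)
  have "h = 0 \<or> k = 0 \<or> (\<exists>c. k = c *\<^sub>R h)"
  proof (cases "h $ 1 = 0")
    case False
    then have "k = (k $ 1 / h $ 1) *\<^sub>R h"
      using hk by (simp add: vec_eq_iff forall_2 field_simps)
    then show ?thesis
      by blast
  next
    case True
    show ?thesis
    proof (cases "h $ 2 = 0")
      case False
      then have "k = (k $ 2 / h $ 2) *\<^sub>R h"
        using hk True by (simp add: vec_eq_iff forall_2)
      then show ?thesis
        by blast
    qed (use True in \<open>simp add: vec_eq_iff forall_2\<close>)
  qed
  then have "collinear {0, h, k}"
    unfolding collinear_lemma .
  then have "collinear {q2, q1, q3}"
    by (simp add: collinear_3 h_def k_def)
  then show False
    using assms by (simp add: insert_commute)
qed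

lemma affine_map_bary:
  assumes "affine_map A" "A q1 = q1" "A q2 = q2" "A q3' = q3" "a + b + w = 1"
  shows "A (bary q1 q2 q3' a b w) = bary q1 q2 q3 a b w"
proof -
  obtain L d where L: "linear L" "\<And>x. A x = L x + d"
    using assms(1) unfolding affine_map_def by blast
  have "d = a *\<^sub>R d + b *\<^sub>R d + w *\<^sub>R d"
    using assms(5) by (simp add: scaleR_left_distrib[symmetric])
  then have "A (bary q1 q2 q3' a b w) = a *\<^sub>R A q1 + b *\<^sub>R A q2 + w *\<^sub>R A q3'"
    unfolding L bary_def linear_add[OF L(1)] linear_scale[OF L(1)] scaleR_right_distrib by (simp add: ac_simps)
  then show ?thesis
    using assms by (simp add: bary_def)
qed

theorem theorem5p2:
  fixes p1 p2 p3 p3' :: "real ^ 2"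
    and A :: "real ^ 2 \<Rightarrow> real ^ 2"
    and c c' :: "nat \<Rightarrow> real"
    and \<beta>1 \<beta>2 \<beta>3 :: real
    and F F' :: "real ^ 2 \<Rightarrow> real"
  assumes "\<not> collinear {p1, p2, p3}" and "\<not> collinear {p1, p2, p3'}"
    and "affine_map A" and "A p1 = p1" and "A p2 = p2" and "A p3' = p3"
    and "\<And>x. x \<in> convex hull {p1, p2, p3} \<Longrightarrow>
           F x = (\<Sum>i=1..16. c i * S3 p1 p2 p3 (reorder i) x)"
    and "\<And>x. x \<in> convex hull {p1, p2, p3'} \<Longrightarrow>
           F' x = (\<Sum>i=1..16. c' i * (S3 p1 p2 p3 (reorder i) \<circ> A) x)"
    and "\<beta>1 + \<beta>2 + \<beta>3 = 1"
    and "p3' = \<beta>1 *\<^sub>R p1 + \<beta>2 *\<^sub>R p2 + \<beta>3 *\<^sub>R p3"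
  shows
    "(meet_smoothly 0 (closed_segment p1 p2)
        (convex hull {p1, p2, p3}) F (convex hull {p1, p2, p3'}) F' \<longleftrightarrow>
      (c' 1 = c 1 \<and> c' 2 = c 2 \<and> c' 3 = c 3 \<and> c' 4 = c 4 \<and> c' 5 = c 5)) \<and>
     (meet_smoothly 1 (closed_segment p1 p2)
        (convex hull {p1, p2, p3}) F (convex hull {p1, p2, p3'}) F' \<longleftrightarrow>
      (c' 1 = c 1 \<and> c' 2 = c 2 \<and> c' 3 = c 3 \<and> c' 4 = c 4 \<and> c' 5 = c 5) \<and>
      (c' 6 = \<beta>1 * c 1 + \<beta>2 * c 2 + \<beta>3 * c 6 \<and>
       c' 7 = \<beta>1 * c 2 + \<beta>2 * ((c 2 + c 3) / 2) + \<beta>3 * c 7 \<and>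
       c' 9 = \<beta>1 * c 4 + \<beta>2 * c 5 + \<beta>3 * c 9 \<and>
       c' 8 = \<beta>2 * c 4 + \<beta>1 * ((c 3 + c 4) / 2) + \<beta>3 * c 8)) \<and>
     (meet_smoothly 2 (closed_segment p1 p2)
        (convex hull {p1, p2, p3}) F (convex hull {p1, p2, p3'}) F' \<longleftrightarrow>
      (c' 1 = c 1 \<and> c' 2 = c 2 \<and> c' 3 = c 3 \<and> c' 4 = c 4 \<and> c' 5 = c 5) \<and>
      (c' 6 = \<beta>1 * c 1 + \<beta>2 * c 2 + \<beta>3 * c 6 \<and>
       c' 7 = \<beta>1 * c 2 + \<beta>2 * ((c 2 + c 3) / 2) + \<beta>3 * c 7 \<and>
       c' 9 = \<beta>1 * c 4 + \<beta>2 * c 5 + \<beta>3 * c 9 \<and>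
       c' 8 = \<beta>2 * c 4 + \<beta>1 * ((c 3 + c 4) / 2) + \<beta>3 * c 8) \<and>
      (c' 10 = 2 * \<beta>1 * \<beta>2 * ((3 * c 2 - c 1) / 2) + 2 * \<beta>1 * \<beta>3 * ((3 * c 6 - c 1) / 2)
             + 2 * \<beta>2 * \<beta>3 * ((4 * c 7 - c 2 - c 6) / 2)
             + \<beta>1\<^sup>2 * c 1 + \<beta>2\<^sup>2 * c 3 + \<beta>3\<^sup>2 * c 10 \<and>
       c' 12 = 2 * \<beta>1 * \<beta>2 * ((3 * c 4 - c 5) / 2) + 2 * \<beta>2 * \<beta>3 * ((3 * c 9 - c 5) / 2)
             + 2 * \<beta>1 * \<beta>3 * ((4 * c 8 - c 4 - c 9) / 2)
             + \<beta>1\<^sup>2 * c 3 + \<beta>2\<^sup>2 * c 5 + \<beta>3\<^sup>2 * c 12 \<and>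
       c' 11 = 2 * \<beta>1 * \<beta>2 * ((c 1 - 2 * c 2 + 4 * c 3 - 2 * c 4 + c 5) / 2) + \<beta>3\<^sup>2 * c 11
             + 2 * \<beta>1 * \<beta>3 * ((c 1 - 2 * c 2 + c 3 - 3 * c 6 + 6 * c 7 - 2 * c 8 + c 9) / 2)
             + \<beta>2\<^sup>2 * (2 * c 4 - c 5)
             + 2 * \<beta>2 * \<beta>3 * ((c 3 - 2 * c 4 + c 5 - 3 * c 9 + 6 * c 8 - 2 * c 7 + c 6) / 2)
             + \<beta>1\<^sup>2 * (2 * c 2 - c 1)))"
proof -
  note collinear = assms(1,2) and A = assms(3-6) and F = assms(7) and F' = assms(8)
    and sum_\<beta> = assms(9) and p3' = assms(10)
  interpret T: plane_triangle p1 p2 p3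
    by unfold_locales (rule jac_nonzero[OF collinear(1)])
  interpret T': plane_triangle p1 p2 p3'
    by unfold_locales (rule jac_nonzero[OF collinear(2)])
  let ?C0 = "c' 1 = c 1 \<and> c' 2 = c 2 \<and> c' 3 = c 3 \<and> c' 4 = c 4 \<and> c' 5 = c 5"
  have ext: "\<forall>x\<in>convex hull {p1, p2, p3}. F x = T.spline_ext c x"
    using F T.S3_sum_eq_spline_ext by simp
  have ext': "\<forall>x\<in>convex hull {p1, p2, p3'}. F' x = T'.spline_ext c' x"
  proof
    fix x assume x: "x \<in> convex hull {p1, p2, p3'}"
    obtain a b w where abw: "0 \<le> a" "0 \<le> b" "0 \<le> w" "a + b + w = 1" "x = bary p1 p2 p3' a b w"
      using T'.mem_triangle_bary[OF x] .
    have "F' x = reordered_sum c' (S3_list p1 p2 p3 (A x))"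
      unfolding F'[OF x] by (simp add: reordered_sum_def S3_def)
    \<comment> \<open>\<open>A\<close> preserves barycentric combinations, so the transported spline
      is the same closed form in the coordinates of the second triangle.\<close>
    also have "A x = bary p1 p2 p3 a b w"
      unfolding abw(5) by (rule affine_map_bary[OF A abw(4)])
    finally show "F' x = T'.spline_ext c' x"
      using abw by (simp add: T'.spline_ext_def T'.coords_bary S3_list_bary[OF T.nz])
  qed
  have seg: "(\<forall>x\<in>closed_segment p1 p2. P x) \<longleftrightarrow> (\<forall>t\<in>{0..1}. P ((1 - t) *\<^sub>R p1 + t *\<^sub>R p2))" for P
    unfolding closed_segment_image_interval by blast
  have u: "T.db (p2 - p1) = 1" "T.dw (p2 - p1) = 0" "T'.db (p2 - p1) = 1" "T'.dw (p2 - p1) = 0"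
    using T.coord_dirs[of 1 0] T'.coord_dirs[of 1 0] by simp_all
  have "\<beta>1 = 1 - \<beta>2 - \<beta>3"
    using sum_\<beta> by simp
  then have "p3' - p1 = \<beta>2 *\<^sub>R (p2 - p1) + \<beta>3 *\<^sub>R (p3 - p1)"
    unfolding p3' by (simp only:) (simp add: algebra_simps)
  then have v: "T.db (p3' - p1) = \<beta>2" "T.dw (p3' - p1) = \<beta>3" "T'.db (p3' - p1) = 0" "T'.dw (p3' - p1) = 1"
    using T.coord_dirs[of \<beta>2 \<beta>3] T'.coord_dirs[of 0 1] by simp_all
  note jets = seg T.edge_coords T'.edge_coords u v T.spline_ext_def T'.spline_ext_def T.spline_D1_def T'.spline_D1_def
    T.spline_D2_def T'.spline_D2_def edge_jet0_def[symmetric] edge_jet1_def[symmetric] edge_jet2_def[symmetric]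
  note meet = meet_smoothly_iff[OF T.nz T'.nz T.spline_C2[of c] T'.spline_C2[of c'] ext ext', unfolded jets edge_jet0_eq_iff]
  \<comment> \<open>If an equation of lower order fails, both sides of every higher equivalence are
    false, so the jets of the next order need to be studied only where the lower equations
    hold.\<close>
  show ?thesis
  proof (cases ?C0)
    case False
    then show ?thesis
      unfolding meet by blast
  next
    case True
    interpret C0_edge c c' \<beta>1 \<beta>2 \<beta>3
      by unfold_locales (use sum_\<beta> True in auto)
    show ?thesis
    proof (cases "c' 6 = \<beta>1 * c 1 + \<beta>2 * c 2 + \<beta>3 * c 6 \<and>
       c' 7 = \<beta>1 * c 2 + \<beta>2 * ((c 2 + c 3) / 2) + \<beta>3 * c 7 \<and>
       c' 9 = \<beta>1 * c 4 + \<beta>2 * c 5 + \<beta>3 * c 9 \<and>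
       c' 8 = \<beta>2 * c 4 + \<beta>1 * ((c 3 + c 4) / 2) + \<beta>3 * c 8")
      case False
      then show ?thesis
        unfolding meet edge_jet1_eq_iff by blast
    next
      case C1: True
      interpret C1_edge c c' \<beta>1 \<beta>2 \<beta>3
        by unfold_locales (use C1 in auto)
      show ?thesis
        unfolding meet edge_jet1_eq_iff edge_jet2_eq_iff by blast
    qed
  qed
qed

end
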